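(* Let $G:\mathbb{R}^p\to\mathbb{R}^p$ satisfy the structural assumption (zero set nonempty and generalized co-coercivity with constants $\beta,\bar\beta\ge 0$ and function $\mathcal{D}$) described in the context. Let $\{(x^k,y^k,z^k)\}$ be generated by the accelerated fixed-point (AFP) scheme of the context such that the estimators $\widetilde G^k$ satisfy the error approximation condition of the context, with $\Theta\bar\beta\le\hat\Theta\beta$, with $\alpha:=\frac{2s+1}{(s+1)^2}<\kappa\le 1$ for a given $s>1$, and with bounded delays $0\le\tau_k\le\tau$ for a given $\tau\ge1$. Let $\gamma\in[0,1]$ with $s\ge1+3\gamma$. Put $\Lambda:=1+s-\gamma$, $\theta:=1-(1-\kappa)\alpha>0$, and $$\bar\eta:=\begin{cases}\dfrac{3\theta\bar\beta}{7\Lambda\hat\Theta} & \text{if } 0<\bar\beta\le\dfrac{7\Lambda\hat\Theta\beta}{7\Lambda\Theta+3\theta(1+\tau)},\\[2ex] \dfrac{3\theta\beta}{7\Lambda\Theta+3\theta(1+\tau)} & \text{if } \bar\beta=0\ \text{ or }\ \dfrac{7\Lambda\hat\Theta\beta}{7\Lambda\Theta+3\theta(1+\tau)}\le\bar\beta\le\dfrac{\hat\Theta}{\Theta}\beta.\end{cases}$$ Suppose the parameters are updated as $t_k:=k+3s+\tau$, $\gamma_k:=\gamma$, $\eta_k:=\frac{\eta t_k}{2(t_k-s)}$, where $0<\eta\le\bar\eta$. If additionally $\sum_{k=0}^\infty\delta_k<+\infty$, then the following summability bounds hold almost surely: $$\sum_{k=0}^\infty(k+\tau)\|Gy^k\|^2<+\infty\qquad\text{and}\qquad\sum_{k=0}^\infty(k+\tau)\|x^{k+1}-x^k\|^2<+\infty.$$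 Moreover, the following limits hold almost surely: $$\lim_{k\to\infty}(k+\tau)^2\|Gy^k\|^2=0\qquad\text{and}\qquad\lim_{k\to\infty}(k+\tau)^2\|x^{k+1}-x^k\|^2=0.$$ Finally, the iterate sequences $\{x^k\}$, $\{y^k\}$ and $\{z^k\}$ converge almost surely to a $\mathrm{zer}(G)$-valued random variable $x^\star$, i.e. a solution of $Gx^\star=0$.
   Context: Norms are induced by the inner product $\langle\cdot,\cdot\rangle$ of $\mathbb{R}^p$; $[a]_+:=\max\{a,0\}$; an empty sum is $0$; the convention $c/0=+\infty$ for $c\ge0$ is used when necessary. Structural assumption on $G$. (1) $\mathrm{zer}(G):=\{x\in\mathbb{R}^p: Gx=0\}\ne\emptyset$. (2) There are $\beta,\bar\beta\in[0,+\infty)$ and $\mathcal{D}:\mathbb{R}^p\times\mathbb{R}^p\to[0,\infty)$ with $\mathcal{D}(x,x)=0$ for all $x$ such that $\langle Gx-Gy,x-y\rangle\ge\beta\|Gx-Gy\|^2+\bar\beta\,\mathcal{D}(x,y)$ for all $x,y\in\mathbb{R}^p$. AFP scheme. Given a constant $s>1$ and an initial point $y^0\in\mathbb{R}^p$, set $z^0:=y^0$. At each iteration $k\ge0$, a delayed inexact estimator $\widetilde G^k$ of $Gy^k$ (deterministic or stochastic) is computed, and $$x^{k+1}:=y^k-\eta_k\widetilde G^k,\qquad z^{k+1}:=z^k+\tfrac{\gamma_k}{s}(x^{k+1}-y^k),\qquad y^{k+1}:=\tfrac{t_k-s}{t_k}x^{k+1}+\tfrac{s}{t_k}z^{k+1}.$$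 The vector $x^0\in\mathbb{R}^p$ is a starting vector which does not enter these updates. Filtration. $\mathcal{F}_k$ is the $\sigma$-algebra generated by all the randomness induced by $x^0,\dots,x^k$, up to the $k$-th iteration; $\mathbb{E}_k[\cdot]:=\mathbb{E}[\cdot\mid\mathcal{F}_k]$. Error approximation condition. Let $e^k:=\widetilde G^k-Gy^k$, adapted to the filtration $\{\mathcal{F}_k\}$. There are a sequence of nonnegative random variables $\{\Delta_k\}$, constants $\kappa\in(0,1]$, $\Theta\ge0$, $\hat\Theta\ge0$, integer delays $\tau_k\in[0,\tau]$, and a nonnegative sequence $\{\delta_k\}$ such that, almost surely, $$\mathbb{E}_k[\|e^k\|^2]\le\mathbb{E}_k[\Delta_k],$$ $$\mathbb{E}_k[\Delta_k]\le(1-\kappa)\Delta_{k-1}+\sum_{l=[k-\tau_k+1]_+}^{k}\big[\Theta\|Gy^l-Gy^{l-1}\|^2+\hat\Theta\,\mathcal{D}(y^l,y^{l-1})\big]+\frac{\delta_k}{t_k(t_k-s)},$$ where $y^{j}:=y^0$ for $j<0$. If $\beta=0$ then $\Theta=0$, and if $\bar\beta=0$ then $\hat\Theta=0$.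
   Formalization: The formal theorem assumes 0 < γ ≤ 1 instead of γ ∈ [0,1]; for γ = 0 one has z^k = y^0 for all k, so the claim fails unless Gy^0 = 0 (e.g. Gx = x on the real line with exact estimators and y^0 = 1). *)

theory Defs
  imports "HOL-Probability.Probability"
begin

definition zer :: "('a \<Rightarrow> 'a::zero) \<Rightarrow> 'a set" where
  "zer G = {x. G x = 0}"

definition structural_assumption ::
    "('a::real_inner \<Rightarrow> 'a) \<Rightarrow> real \<Rightarrow> real \<Rightarrow> ('a \<Rightarrow> 'a \<Rightarrow> real) \<Rightarrow> bool" where
  "structural_assumption G \<beta> \<beta>' D \<longleftrightarrow>
     zer G \<noteq> {} \<and> 0 \<le> \<beta> \<and> 0 \<le> \<beta>' \<and>
     (\<forall>x y. 0 \<le> D x y) \<and> (\<forall>x. D x x = 0) \<and>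
     (\<forall>x y. inner (G x - G y) (x - y) \<ge> \<beta> * (norm (G x - G y))\<^sup>2 + \<beta>' * D x y)"

text \<open>
  The estimators \<open>Gt k\<close> and the iterates are functions on the sample space \<open>\<Omega>\<close>; the
  starting vectors \<open>x0\<close> and \<open>y0\<close> are deterministic, and \<open>x0\<close> enters no update.
  For \<open>\<gamma> = 0\<close> the sequence \<open>z\<close> is constantly \<open>y0\<close>, so it can converge to a zero of \<open>G\<close>
  only if \<open>y0\<close> already is one; convergence results need \<open>\<gamma> > 0\<close>.
\<close>

definition afp_scheme ::
    "'w set \<Rightarrow> real \<Rightarrow> (nat \<Rightarrow> real) \<Rightarrow> (nat \<Rightarrow> real) \<Rightarrow> (nat \<Rightarrow> real) \<Rightarrow>
     'a::real_vector \<Rightarrow> 'a \<Rightarrow> (nat \<Rightarrow> 'w \<Rightarrow> 'a) \<Rightarrow>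
     (nat \<Rightarrow> 'w \<Rightarrow> 'a) \<Rightarrow> (nat \<Rightarrow> 'w \<Rightarrow> 'a) \<Rightarrow> (nat \<Rightarrow> 'w \<Rightarrow> 'a) \<Rightarrow> bool" where
  "afp_scheme \<Omega> s t \<gamma> \<eta> x0 y0 Gt x y z \<longleftrightarrow>
     (\<forall>\<omega>\<in>\<Omega>.
        x 0 \<omega> = x0 \<and> y 0 \<omega> = y0 \<and> z 0 \<omega> = y0 \<and>
        (\<forall>k. x (Suc k) \<omega> = y k \<omega> - \<eta> k *\<^sub>R Gt k \<omega> \<and>
             z (Suc k) \<omega> = z k \<omega> + (\<gamma> k / s) *\<^sub>R (x (Suc k) \<omega> - y k \<omega>) \<and>
             y (Suc k) \<omega> = ((t k - s) / t k) *\<^sub>R x (Suc k) \<omega> + (s / t k) *\<^sub>R z (Suc k) \<omega>))"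

text \<open>
  \<open>F k\<close> is any filtration to which the iterates \<open>x k\<close> are adapted. It may be larger than the
  \<open>\<sigma>\<close>-algebra generated by \<open>x 0, \<dots>, x k\<close>, so that it can also carry the internal randomness
  used to compute them.
\<close>

definition afp_filtration ::
    "'w measure \<Rightarrow> (nat \<Rightarrow> 'w measure) \<Rightarrow> (nat \<Rightarrow> 'w \<Rightarrow> 'a::topological_space) \<Rightarrow> bool" where
  "afp_filtration M F x \<longleftrightarrow>
     filtration (space M) F \<and> (\<forall>k. subalgebra M (F k)) \<and> (\<forall>k. x k \<in> borel_measurable (F k))"

text \<open>
  Conditional expectations of the nonnegative variables are taken in \<open>[0, \<infinity>]\<close>, so no
  integrability is presupposed. The error \<open>e k\<close> is revealed together with \<open>x (k + 1)\<close>, hence it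
  is required to be measurable with respect to \<open>F (Suc k)\<close>; this includes the case of
  \<open>F k\<close>-measurable errors. The sequence \<open>\<Delta>\<close> is indexed by integers because \<open>\<Delta> (- 1)\<close>
  occurs for \<open>k = 0\<close>. Truncated subtraction on naturals renders both the positive part in the
  lower summation bound \<open>k + 1 - d k\<close> and the convention that \<open>y (- 1)\<close> is \<open>y 0\<close>.
\<close>

definition error_condition ::
    "'w measure \<Rightarrow> (nat \<Rightarrow> 'w measure) \<Rightarrow> real \<Rightarrow> (nat \<Rightarrow> real) \<Rightarrow> real \<Rightarrow>
     ('a::euclidean_space \<Rightarrow> 'a) \<Rightarrow> real \<Rightarrow> real \<Rightarrow> ('a \<Rightarrow> 'a \<Rightarrow> real) \<Rightarrow>
     (nat \<Rightarrow> 'w \<Rightarrow> 'a) \<Rightarrow> (nat \<Rightarrow> 'w \<Rightarrow> 'a) \<Rightarrow>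
     (int \<Rightarrow> 'w \<Rightarrow> real) \<Rightarrow> real \<Rightarrow> real \<Rightarrow> real \<Rightarrow> (nat \<Rightarrow> nat) \<Rightarrow> (nat \<Rightarrow> real) \<Rightarrow> bool" where
  "error_condition M F s t \<tau> G \<beta> \<beta>' D y Gt \<Delta> \<kappa> \<Theta> \<Theta>' d \<delta> \<longleftrightarrow>
     (let e = (\<lambda>k \<omega>. Gt k \<omega> - G (y k \<omega>)) in
      (\<forall>k. e k \<in> borel_measurable (F (Suc k))) \<and>
      (\<forall>j\<ge>-1. \<Delta> j \<in> borel_measurable M \<and> (\<forall>\<omega>\<in>space M. 0 \<le> \<Delta> j \<omega>)) \<and>
      0 < \<kappa> \<and> \<kappa> \<le> 1 \<and> 0 \<le> \<Theta> \<and> 0 \<le> \<Theta>' \<and>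
      (\<forall>k. real (d k) \<le> \<tau>) \<and> (\<forall>k. 0 \<le> \<delta> k) \<and>
      (\<forall>k. AE \<omega> in M.
         nn_cond_exp M (F k) (\<lambda>\<omega>. ennreal ((norm (e k \<omega>))\<^sup>2)) \<omega>
           \<le> nn_cond_exp M (F k) (\<lambda>\<omega>. ennreal (\<Delta> (int k) \<omega>)) \<omega>) \<and>
      (\<forall>k. AE \<omega> in M.
         nn_cond_exp M (F k) (\<lambda>\<omega>. ennreal (\<Delta> (int k) \<omega>)) \<omega>
           \<le> ennreal ((1 - \<kappa>) * \<Delta> (int k - 1) \<omega>
               + (\<Sum>l = k + 1 - d k..k.
                    \<Theta> * (norm (G (y l \<omega>) - G (y (l - 1) \<omega>)))\<^sup>2
                    + \<Theta>' * D (y l \<omega>) (y (l - 1) \<omega>))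
               + \<delta> k / (t k * (t k - s)))) \<and>
      (\<beta> = 0 \<longrightarrow> \<Theta> = 0) \<and> (\<beta>' = 0 \<longrightarrow> \<Theta>' = 0))"

text \<open>
  Where both conditions hold, the two formulas agree. The disjunct \<open>\<Theta> = 0\<close> is the convention
  that \<open>\<Theta>' / 0\<close> is infinite.
\<close>

definition eta_bar :: "real \<Rightarrow> real \<Rightarrow> real \<Rightarrow> real \<Rightarrow> real \<Rightarrow> real \<Rightarrow> real \<Rightarrow> real" where
  "eta_bar \<Lambda> \<theta> \<tau> \<beta> \<beta>' \<Theta> \<Theta>' =
     (let c = 7 * \<Lambda> * \<Theta>' * \<beta> / (7 * \<Lambda> * \<Theta> + 3 * \<theta> * (1 + \<tau>)) in
      if 0 < \<beta>' \<and> \<beta>' \<le> c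
        then 3 * \<theta> * \<beta>' / (7 * \<Lambda> * \<Theta>')
      else if \<beta>' = 0 \<or> (c \<le> \<beta>' \<and> (\<Theta> = 0 \<or> \<beta>' \<le> \<Theta>' / \<Theta> * \<beta>))
        then 3 * \<theta> * \<beta> / (7 * \<Lambda> * \<Theta> + 3 * \<theta> * (1 + \<tau>))
      else undefined)"

end

theory Submission
  imports Defs
begin

text \<open>
  Write \<open>g k = G (y k)\<close>, \<open>v k = y k - z k\<close> and let \<open>e k\<close> be the estimator error. For every zero \<open>p\<close>
  of \<open>G\<close>, the energy
  \<open>Z k = s (t k - 1) <g k, v k> + (\<eta> / 4) (t k - 1)^2 |g k|^2 + (w + M0 / t k) |z k - p|^2\<close>
  is nonnegative and eventually satisfies, along every path,
  \<open>Z (k + 1) + (c / 4) t k |g k|^2 + b (t k)^2 S (k + 1) \<le> Z k + 4 \<epsilon> (t k)^2 |e k|^2\<close>,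
  where \<open>S (k + 1)\<close> dominates the increment that the error condition charges for \<open>(y (k + 1), y k)\<close>.
  Integrating over an event of \<open>F K\<close> on which everything at time \<open>K\<close> is bounded turns this and the
  error recursion into two recursions of real sequences; since \<open>b\<close> exceeds
  \<open>4 N (4 \<epsilon>) / \<kappa>\<close>, they yield summability of \<open>t k |g k|^2\<close> and \<open>(t k)^2 |e k|^2\<close> almost surely.

  The rest is deterministic. The recursion \<open>v (k + 1) = (1 - s / t k) (v k - O(1) (g k + e k))\<close> gives
  summability of \<open>|v k|^2 / t k\<close> and \<open>v k \<rightarrow> 0\<close>. Then the part of \<open>Z k\<close> without \<open>|z k - p|^2\<close> converges,
  necessarily to \<open>0\<close>, whence \<open>(t k)^2 |g k|^2 \<rightarrow> 0\<close>, and \<open>|z k - p|\<close> converges for every zero \<open>p\<close>. As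
  cluster points of \<open>z\<close> are zeros of \<open>G\<close>, the sequence \<open>z\<close> converges. No null set depends on \<open>p\<close>, so no
  martingale convergence theorem is needed.
\<close>

subsection \<open>Inequalities and real sequences\<close>

text \<open>The quadratic form \<open>c a^2 - q a b + d b^2\<close> has nonpositive discriminant;
  multiplying it by \<open>4 c\<close> completes the square.\<close>

lemma Young_ineq:
  fixes a b c q :: real
  assumes "0 < c" "q\<^sup>2 \<le> 4 * c * d"
  shows "q * a * b \<le> c * a\<^sup>2 + d * b\<^sup>2"
proof -
  have "4 * c * (c * a\<^sup>2 + d * b\<^sup>2 - q * a * b) = (2 * c * a - q * b)\<^sup>2 + (4 * c * d - q\<^sup>2) * b\<^sup>2"
    by (simp add: power2_eq_square algebra_simps)
  also have "\<dots> \<ge> 0" using assms by simp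
  finally show ?thesis using assms(1) by (simp add: zero_le_mult_iff)
qed

text \<open>Subtracting the partial sums of \<open>e\<close> turns \<open>a\<close> into an
  eventually decreasing sequence. Convergence of the series keeps this sequence bounded below and
  carries its limit back to \<open>a\<close>.\<close>

lemma convergent_quasi_decreasing:
  fixes a e :: "nat \<Rightarrow> real"
  assumes step: "\<And>k. k \<ge> K \<Longrightarrow> a (Suc k) \<le> a k + e k"
    and e: "summable e" and low: "\<And>k. k \<ge> K \<Longrightarrow> B \<le> a k"
  shows "convergent a"
proof -
  define b where "b k = a (k + K) - (\<Sum>i<k + K. e i)" for k
  obtain C where C: "\<And>n. norm (\<Sum>i<n. e i) \<le> C"
    using convergent_imp_Bseq[OF e[unfolded summable_iff_convergent]] unfolding Bseq_def by blast
  have dec: "decseq b"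
    unfolding decseq_Suc_iff b_def using step by (simp add: algebra_simps)
  have "B - C \<le> b k" for k
    unfolding b_def using low[of "k + K"] C[of "k + K"] by auto
  then obtain L where L: "b \<longlonglongrightarrow> L"
    using decseq_convergent[OF dec] by metis
  have "(\<lambda>k. \<Sum>i<k + K. e i) \<longlonglongrightarrow> suminf e"
    using summable_LIMSEQ[OF e] by (rule LIMSEQ_ignore_initial_segment)
  from tendsto_add[OF L this] have "(\<lambda>k. a (k + K)) \<longlonglongrightarrow> L + suminf e"
    by (simp add: b_def)
  then show ?thesis
    using LIMSEQ_offset convergent_def by blast
qed

text \<open>A positive limit would make \<open>a k / t k\<close> dominate a multiple of the harmonic
  series, because \<open>t k\<close> grows linearly.\<close>

lemma tendsto_zero_if_harmonic_summable:
  fixes a t :: "nat \<Rightarrow> real"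
  assumes "convergent a" "\<And>k. 0 \<le> a k" "summable (\<lambda>k. a k / t k)"
    and t: "\<And>k. t k = real k + C" and "C > 0"
  shows "a \<longlonglongrightarrow> 0"
proof -
  obtain L where L: "a \<longlonglongrightarrow> L" using assms(1) by (auto simp: convergent_def)
  have "L \<ge> 0" using L assms(2) by (meson LIMSEQ_le_const)
  moreover have "\<not> L > 0"
  proof
    assume "L > 0"
    then have "eventually (\<lambda>k. L / 2 < a k) sequentially"
      using order_tendstoD(1)[OF L, of "L / 2"] by simp
    then obtain n where n: "\<And>k. k \<ge> n \<Longrightarrow> L / 2 < a k"
      by (auto simp: eventually_sequentially)
    have "norm (inverse (real (Suc k))) \<le> (2 * (1 + C) / L) * (a k / t k)" if "k \<ge> n" for k
    proof -
      have "t k \<le> (1 + C) * real (Suc k)" "0 < t k"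
        using assms(5) by (auto simp: t algebra_simps)
      then have "inverse (real (Suc k)) \<le> (1 + C) / t k"
        by (simp add: field_simps)
      also have "\<dots> \<le> (1 + C) / t k * (2 / L * a k)"
        using n[OF that] \<open>L > 0\<close> \<open>0 < t k\<close> assms(5)
        by (intro mult_le_cancel_left1[THEN iffD2]) (auto simp: field_simps)
      finally show ?thesis by (simp add: field_simps)
    qed
    then have "summable (\<lambda>k. inverse (real (Suc k)))"
      by (intro summable_comparison_test[OF _ summable_mult[OF assms(3)]]) blast
    then have "summable (\<lambda>k. inverse (real k))"
      by (rule summable_Suc_iff[THEN iffD1])
    then show False using not_summable_harmonic[where 'a=real] by simp
  qed
  ultimately show ?thesis using L by simp
qed

text \<open>Let \<open>E\<close> and \<open>Q\<close> be the partial sums of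
  \<open>(t k)^2 * q k\<close> and \<open>(t k)^2 * S (Suc k)\<close>. The error recursion sums to
  \<open>E \<le> const + (4 N / \<kappa>) Q\<close>, the energy recursion to
  \<open>sum y + b Q \<le> const + C0 E\<close>. Inserting the first into the second, the lower
  bound on \<open>b\<close> leaves a positive multiple of \<open>Q\<close> on the left, which bounds
  everything.\<close>

lemma energy_recursion_summable:
  fixes z y S e q \<delta> t :: "nat \<Rightarrow> real" and d :: "nat \<Rightarrow> nat"
  assumes nn: "\<And>k. k \<ge> K \<Longrightarrow> 0 \<le> z k" "\<And>k. 0 \<le> y k" "\<And>k. 0 \<le> S k"
      "\<And>k. 0 \<le> e k" "\<And>k. 0 \<le> q k" "\<And>k. 0 \<le> \<delta> k"
    and dec: "\<And>k. k \<ge> K \<Longrightarrow> z (Suc k) + y k + b * (t k)\<^sup>2 * S (Suc k) \<le> z k + C0 * (t k)\<^sup>2 * e k"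
    and eq: "\<And>k. k \<ge> K \<Longrightarrow> e k \<le> q k"
    and rec: "\<And>k. k \<ge> K \<Longrightarrow> (t (Suc k))\<^sup>2 * q (Suc k) \<le> (1 - \<kappa>) * (t (Suc k))\<^sup>2 * q k
         + (t (Suc k))\<^sup>2 * (\<Sum>l = Suc k + 1 - d (Suc k)..Suc k. S l) + 2 * \<delta> (Suc k)"
    and d: "\<And>k. d k \<le> N" and KN: "N \<le> K" and K1: "K \<ge> 1"
    and t1: "\<And>k. k \<ge> K \<Longrightarrow> (1 - \<kappa>) * (t (Suc k))\<^sup>2 \<le> (1 - \<kappa> / 2) * (t k)\<^sup>2"
    and t2: "\<And>k j. k \<ge> K \<Longrightarrow> j < N \<Longrightarrow> (t (Suc k))\<^sup>2 \<le> 2 * (t (k - j))\<^sup>2"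
    and kap: "0 < \<kappa>" "\<kappa> \<le> 1" and C0: "C0 \<ge> 0" and b: "4 * real N * C0 / \<kappa> < b"
    and del: "summable \<delta>"
  shows "summable y" "summable (\<lambda>k. (t k)\<^sup>2 * e k)"
proof -
  define r where "r k = (t k)\<^sup>2 * S (Suc k)" for k
  define Q where "Q n = sum r {K..<n}" for n
  define E where "E n = (\<Sum>k=K..<n. (t k)\<^sup>2 * q k)" for n
  define R0 where "R0 = sum r {..<K}"
  have r0: "r k \<ge> 0" for k unfolding r_def using nn by simp
  have Q0: "Q n \<ge> 0" for n unfolding Q_def using r0 by (intro sum_nonneg) auto
  \<comment> \<open>A shift of the index only brings in terms before \<open>K\<close>, which
    \<open>R0\<close> collects. Since \<open>j < N \<le> K\<close>, truncated subtraction is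
    injective on the range of summation.\<close>
  have win: "(\<Sum>k=K..<n. r (k - j)) \<le> R0 + Q n" if "j < N" "n \<ge> K" for j n
  proof -
    have "(\<Sum>k=K..<n. r (k - j)) = sum r ((\<lambda>k. k - j) ` {K..<n})"
      using that KN by (subst sum.reindex) (auto simp: inj_on_def)
    also have "\<dots> \<le> sum r {..<n}" using r0 by (intro sum_mono2) auto
    also have "{..<n} = {..<K} \<union> {K..<n}" using that by auto
    also have "sum r ({..<K} \<union> {K..<n}) = R0 + Q n"
      unfolding R0_def Q_def by (intro sum.union_disjoint) auto
    finally show ?thesis .
  qed
  \<comment> \<open>A delay window lies among the last \<open>N\<close> indices, and replacing the
    current weight by the weight of the delayed increment costs the factor 2 from
    \<open>t2\<close>.\<close>
  have delay: "(t (Suc k))\<^sup>2 * (\<Sum>l = Suc k + 1 - d (Suc k)..Suc k. S l) \<le> 2 * (\<Sum>j<N. r (k - j))"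
    if "k \<ge> K" for k
  proof -
    have "(\<Sum>l = Suc k + 1 - d (Suc k)..Suc k. S l) \<le> (\<Sum>l\<in>(\<lambda>j. Suc k - j) ` {..<N}. S l)"
    proof (intro sum_mono2)
      show "{Suc k + 1 - d (Suc k)..Suc k} \<subseteq> (\<lambda>j. Suc k - j) ` {..<N}"
      proof
        fix l assume "l \<in> {Suc k + 1 - d (Suc k)..Suc k}"
        then show "l \<in> (\<lambda>j. Suc k - j) ` {..<N}"
          using d[of "Suc k"] by (intro image_eqI[of _ _ "Suc k - l"]) auto
      qed
    qed (use nn in auto)
    also have "\<dots> = (\<Sum>j<N. S (Suc k - j))"
      using that KN by (subst sum.reindex) (auto simp: inj_on_def)
    finally have "(t (Suc k))\<^sup>2 * (\<Sum>l = Suc k + 1 - d (Suc k)..Suc k. S l) \<le> (t (Suc k))\<^sup>2 * \<dots>"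
      by (intro mult_left_mono) auto
    also have "\<dots> = (\<Sum>j<N. (t (Suc k))\<^sup>2 * S (Suc k - j))" by (simp add: sum_distrib_left)
    also have "\<dots> \<le> (\<Sum>j<N. 2 * r (k - j))"
    proof (intro sum_mono)
      fix j assume j: "j \<in> {..<N}"
      then have "Suc k - j = Suc (k - j)" using that KN by auto
      then have "(t (Suc k))\<^sup>2 * S (Suc k - j) \<le> (2 * (t (k - j))\<^sup>2) * S (Suc (k - j))"
        using t2[OF that, of j] j nn by (auto intro!: mult_right_mono)
      then show "(t (Suc k))\<^sup>2 * S (Suc k - j) \<le> 2 * r (k - j)" by (simp add: r_def)
    qed
    finally show ?thesis by (simp add: sum_distrib_left)
  qed
  define C where "C = (t K)\<^sup>2 * q K + 2 * N * R0 + 2 * suminf \<delta>"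
  \<comment> \<open>By \<open>t1\<close> the growth of the weights uses up only half of the
    contraction, so \<open>E\<close> reappears on the right with factor
    \<open>1 - \<kappa> / 2\<close> and \<open>\<kappa> / 2 * E\<close> remains on the left.\<close>
  have Ebound: "E n \<le> 2 / \<kappa> * C + 4 * N / \<kappa> * Q n" if n: "n \<ge> K" for n
  proof -
    have "E n \<le> E (Suc n)" unfolding E_def using nn n by simp
    also have "E (Suc n) = (t K)\<^sup>2 * q K + (\<Sum>k=K..<n. (t (Suc k))\<^sup>2 * q (Suc k))"
      unfolding E_def using n
    by (simp add: sum.atLeast_Suc_lessThan sum.shift_bounds_Suc_ivl del: sum.op_ivl_Suc)
    also have "(\<Sum>k=K..<n. (t (Suc k))\<^sup>2 * q (Suc k))
       \<le> (\<Sum>k=K..<n. (1 - \<kappa> / 2) * ((t k)\<^sup>2 * q k) + 2 * (\<Sum>j<N. r (k - j)) + 2 * \<delta> (Suc k))"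
    proof (intro sum_mono)
      fix k assume "k \<in> {K..<n}"
      then have k: "k \<ge> K" by simp
      have "(1 - \<kappa>) * (t (Suc k))\<^sup>2 * q k \<le> (1 - \<kappa> / 2) * (t k)\<^sup>2 * q k"
        using t1[OF k] nn by (intro mult_right_mono) auto
      then show "(t (Suc k))\<^sup>2 * q (Suc k)
         \<le> (1 - \<kappa> / 2) * ((t k)\<^sup>2 * q k) + 2 * (\<Sum>j<N. r (k - j)) + 2 * \<delta> (Suc k)"
        using rec[OF k] delay[OF k] by simp
    qed
    also have "\<dots> = (1 - \<kappa> / 2) * E n + 2 * (\<Sum>j<N. \<Sum>k=K..<n. r (k - j)) + 2 * (\<Sum>k=K..<n. \<delta> (Suc k))"
      unfolding E_def sum.distrib sum_distrib_left[symmetric] by (subst sum.swap) simp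
    also have "(\<Sum>j<N. \<Sum>k=K..<n. r (k - j)) \<le> (\<Sum>j<N. R0 + Q n)"
      using win n by (intro sum_mono) auto
    also have "(\<Sum>k=K..<n. \<delta> (Suc k)) \<le> suminf \<delta>"
    proof -
      have "(\<Sum>k=K..<n. \<delta> (Suc k)) = sum \<delta> {Suc K..<Suc n}" by (simp only: sum.shift_bounds_Suc_ivl)
      also have "\<dots> \<le> suminf \<delta>" using del nn by (intro sum_le_suminf) auto
      finally show ?thesis .
    qed
    finally have "\<kappa> / 2 * E n \<le> C + 2 * N * Q n"
      by (simp add: C_def algebra_simps)
    then have "2 / \<kappa> * (\<kappa> / 2 * E n) \<le> 2 / \<kappa> * (C + 2 * N * Q n)"
      using kap by (intro mult_left_mono) auto
    then show ?thesis using kap by (simp add: algebra_simps)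
  qed
  have tel: "(\<Sum>k=K..<n. y k) + b * Q n \<le> z K + C0 * E n" if n: "n \<ge> K" for n
  proof -
    have "z n + (\<Sum>k=K..<n. y k) + b * Q n \<le> z K + C0 * E n" using n
    proof (induction n rule: dec_induct)
      case base then show ?case by (simp add: Q_def E_def)
    next
      case (step m)
      have "C0 * (t m)\<^sup>2 * e m \<le> C0 * (t m)\<^sup>2 * q m"
        using eq[of m] step C0 by (intro mult_left_mono) auto
      then show ?case
        using step dec[of m] by (simp add: Q_def E_def r_def algebra_simps)
    qed
    then show ?thesis using nn(1)[OF n] by simp
  qed
  define b' where "b' = b - 4 * real N * C0 / \<kappa>"
  define B where "B = z K + C0 * (2 / \<kappa> * C)"
  have main: "(\<Sum>k=K..<n. y k) + b' * Q n \<le> B" if n: "n \<ge> K" for n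
  proof -
    have "C0 * E n \<le> C0 * (2 / \<kappa> * C + 4 * N / \<kappa> * Q n)"
      using Ebound[OF n] C0 by (intro mult_left_mono) auto
    then show ?thesis using tel[OF n] by (simp add: b'_def B_def algebra_simps)
  qed
  have b'0: "b' > 0" using b by (simp add: b'_def)
  have Qle: "Q n \<le> B / b'" if n: "n \<ge> K" for n
    using main[OF n] b'0 sum_nonneg[of "{K..<n}" y] nn by (simp add: field_simps)
  have Ysum: "(\<Sum>k=K..<n. y k) \<le> B" if n: "n \<ge> K" for n
    using main[OF n] b'0 Q0[of n] by (smt (verit) mult_nonneg_nonneg)
  have bnd: "summable f" if "\<And>k. 0 \<le> f k" "\<And>n. n \<ge> K \<Longrightarrow> sum f {K..<n} \<le> X" for f :: "nat \<Rightarrow> real" and X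
  proof (rule summable_iff_shift[THEN iffD1, of f K], rule bounded_imp_summable)
    fix n
    have "(\<Sum>k\<le>n. f (k + K)) = sum f {K..<Suc n + K}"
      using sum.shift_bounds_nat_ivl[of f 0 K "Suc n"] by (simp add: atLeast0LessThan lessThan_Suc_atMost)
    then show "(\<Sum>k\<le>n. f (k + K)) \<le> X" using that(2)[of "Suc n + K"] by simp
  qed (use that in auto)
  show "summable y" using bnd nn Ysum by blast
  show "summable (\<lambda>k. (t k)\<^sup>2 * e k)"
  proof (rule bnd)
    fix n assume n: "n \<ge> K"
    have "(\<Sum>k=K..<n. (t k)\<^sup>2 * e k) \<le> E n"
      unfolding E_def using eq by (intro sum_mono mult_left_mono) auto
    also have "\<dots> \<le> 2 / \<kappa> * C + 4 * N / \<kappa> * Q n" by (rule Ebound[OF n])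
    also have "\<dots> \<le> 2 / \<kappa> * C + 4 * N / \<kappa> * (B / b')"
      using Qle[OF n] kap by (intro add_left_mono mult_left_mono) auto
    finally show "(\<Sum>k=K..<n. (t k)\<^sup>2 * e k) \<le> 2 / \<kappa> * C + 4 * N / \<kappa> * (B / b')" .
  qed (use nn in auto)
qed

lemma norm_add_square_le:
  fixes p q :: "'a::real_normed_vector"
  shows "(norm (p + q))\<^sup>2 \<le> 2 * ((norm p)\<^sup>2 + (norm q)\<^sup>2)"
proof -
  have "(norm (p + q))\<^sup>2 \<le> (norm p + norm q)\<^sup>2"
    by (intro power_mono norm_triangle_ineq norm_ge_zero)
  also have "\<dots> \<le> 2 * ((norm p)\<^sup>2 + (norm q)\<^sup>2)"
    using sum_squares_bound[of "norm p" "norm q"] by (simp add: power2_sum)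
  finally show ?thesis .
qed

lemma cocoercive_lipschitz:
  fixes G :: "'a::real_inner \<Rightarrow> 'a"
  assumes "\<beta> * (norm (G p - G q))\<^sup>2 \<le> inner (G p - G q) (p - q)"
  shows "\<beta> * norm (G p - G q) \<le> norm (p - q)"
proof (cases "G p = G q")
  case False
  have "(\<beta> * norm (G p - G q)) * norm (G p - G q) \<le> norm (p - q) * norm (G p - G q)"
    using assms norm_cauchy_schwarz[of "G p - G q" "p - q"]
    by (simp add: power2_eq_square mult_ac)
  then show ?thesis using False by simp
qed simp

text \<open>Continuity serves twice: it makes \<open>G\<close> Borel measurable, and it shows that
  cluster points of the iterates are zeros of \<open>G\<close>.\<close>

lemma cocoercive_continuous:
  fixes G :: "'a::real_inner \<Rightarrow> 'a"
  assumes "\<beta> > 0" and coco: "\<And>p q. \<beta> * (norm (G p - G q))\<^sup>2 \<le> inner (G p - G q) (p - q)"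
  shows "continuous_on UNIV G"
proof (rule continuous_onI)
  fix p :: 'a and e :: real assume e: "e > 0"
  show "\<exists>d>0. \<forall>q\<in>UNIV. dist q p < d \<longrightarrow> dist (G q) (G p) \<le> e"
  proof (intro exI conjI ballI impI)
    show "\<beta> * e > 0" using assms(1) e by simp
    fix q assume "dist q p < \<beta> * e"
    then have "\<beta> * norm (G q - G p) \<le> \<beta> * e"
      using cocoercive_lipschitz[OF coco[of q p]] by (simp add: dist_norm)
    then show "dist (G q) (G p) \<le> e" using assms(1) by (simp add: dist_norm)
  qed
qed

subsection \<open>Almost sure summability from conditional recursions\<close>

text \<open>The indicator of \<open>A\<close> is \<open>F\<close>-measurable and therefore moves
  under the conditional expectation. A conditional inequality thus becomes an inequality of
  integrals over each event of \<open>F\<close>.\<close>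

lemma (in sigma_finite_subalgebra) nn_set_integral_le_if_nn_cond_exp_le:
  assumes A: "A \<in> sets F" and f[measurable]: "f \<in> borel_measurable M"
    and le: "AE \<omega> in M. nn_cond_exp M F f \<omega> \<le> h \<omega>"
  shows "(\<integral>\<^sup>+\<omega>\<in>A. f \<omega> \<partial>M) \<le> (\<integral>\<^sup>+\<omega>\<in>A. h \<omega> \<partial>M)"
proof -
  have "(\<integral>\<^sup>+\<omega>\<in>A. f \<omega> \<partial>M) = (\<integral>\<^sup>+\<omega>. indicator A \<omega> * f \<omega> \<partial>M)"
    by (simp add: mult.commute)
  also have "\<dots> = (\<integral>\<^sup>+\<omega>. indicator A \<omega> * nn_cond_exp M F f \<omega> \<partial>M)"
    using A by (intro nn_cond_exp_intg[symmetric]) auto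
  also have "\<dots> \<le> (\<integral>\<^sup>+\<omega>. indicator A \<omega> * h \<omega> \<partial>M)"
    by (intro nn_integral_mono_AE) (use le in \<open>auto elim!: eventually_mono intro: mult_left_mono\<close>)
  finally show ?thesis by (simp add: mult.commute)
qed

lemma (in sigma_finite_subalgebra) nn_set_integral_mono_nn_cond_exp:
  assumes A: "A \<in> sets F" and f[measurable]: "f \<in> borel_measurable M" "g \<in> borel_measurable M"
    and le: "AE \<omega> in M. nn_cond_exp M F f \<omega> \<le> nn_cond_exp M F g \<omega>"
  shows "(\<integral>\<^sup>+\<omega>\<in>A. f \<omega> \<partial>M) \<le> (\<integral>\<^sup>+\<omega>\<in>A. g \<omega> \<partial>M)"
proof -
  have "(\<integral>\<^sup>+\<omega>\<in>A. nn_cond_exp M F g \<omega> \<partial>M) = (\<integral>\<^sup>+\<omega>. indicator A \<omega> * nn_cond_exp M F g \<omega> \<partial>M)"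
    by (simp add: mult.commute)
  also have "\<dots> = (\<integral>\<^sup>+\<omega>. indicator A \<omega> * g \<omega> \<partial>M)"
    using A by (intro nn_cond_exp_intg) auto
  finally show ?thesis
    using nn_set_integral_le_if_nn_cond_exp_le[OF A f(1) le] by (simp add: mult.commute)
qed

text \<open>This passes from the extended nonnegative integrals, in which the conditional
  inequalities live, to the real integrals that enter the sequence recursions; integrability comes
  out as a by-product.\<close>

lemma integrable_if_nn_integral_le:
  fixes f g :: "'a \<Rightarrow> real"
  assumes f: "f \<in> borel_measurable N" "\<And>\<omega>. \<omega> \<in> space N \<Longrightarrow> 0 \<le> f \<omega>"
    and g: "integrable N g" "\<And>\<omega>. \<omega> \<in> space N \<Longrightarrow> 0 \<le> g \<omega>"
    and le: "(\<integral>\<^sup>+\<omega>. ennreal (f \<omega>) \<partial>N) \<le> (\<integral>\<^sup>+\<omega>. ennreal (g \<omega>) \<partial>N)"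
  shows "integrable N f" "integral\<^sup>L N f \<le> integral\<^sup>L N g"
proof -
  have gi: "(\<integral>\<^sup>+\<omega>. ennreal (g \<omega>) \<partial>N) = ennreal (integral\<^sup>L N g)"
    using g by (intro nn_integral_eq_integral) auto
  then have "(\<integral>\<^sup>+\<omega>. ennreal (f \<omega>) \<partial>N) < \<infinity>"
    using le by (simp add: le_less_trans)
  then show fi: "integrable N f"
    using f by (intro integrableI_nonneg) auto
  have "(\<integral>\<^sup>+\<omega>. ennreal (f \<omega>) \<partial>N) = ennreal (integral\<^sup>L N f)"
    using f fi by (intro nn_integral_eq_integral) auto
  moreover have "integral\<^sup>L N g \<ge> 0" using g by (intro integral_nonneg_AE) auto
  ultimately show "integral\<^sup>L N f \<le> integral\<^sup>L N g"
    using le gi by simp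
qed

text \<open>Monotone convergence exchanges sum and integral, and a nonnegative function with finite
  integral is finite almost everywhere.\<close>

lemma AE_summable_if_integrals_summable:
  fixes Y :: "nat \<Rightarrow> 'a \<Rightarrow> real"
  assumes int: "\<And>k. integrable N (Y k)" and nn: "\<And>k \<omega>. \<omega> \<in> space N \<Longrightarrow> 0 \<le> Y k \<omega>"
    and sm: "summable (\<lambda>k. integral\<^sup>L N (Y k))"
  shows "AE \<omega> in N. summable (\<lambda>k. Y k \<omega>)"
proof -
  have [measurable]: "Y k \<in> borel_measurable N" for k using int by auto
  have I0: "0 \<le> integral\<^sup>L N (Y k)" for k using nn by (intro integral_nonneg_AE) auto
  have "(\<integral>\<^sup>+\<omega>. (\<Sum>k. ennreal (Y k \<omega>)) \<partial>N) = (\<Sum>k. \<integral>\<^sup>+\<omega>. ennreal (Y k \<omega>) \<partial>N)"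
    by (rule nn_integral_suminf) simp
  also have "\<dots> = (\<Sum>k. ennreal (integral\<^sup>L N (Y k)))"
    using int nn by (subst nn_integral_eq_integral) auto
  also have "\<dots> = ennreal (\<Sum>k. integral\<^sup>L N (Y k))"
    using sm I0 by (intro suminf_ennreal2) auto
  finally have "(\<integral>\<^sup>+\<omega>. (\<Sum>k. ennreal (Y k \<omega>)) \<partial>N) \<noteq> \<infinity>" by simp
  then have "AE \<omega> in N. (\<Sum>k. ennreal (Y k \<omega>)) \<noteq> \<infinity>"
    by (intro nn_integral_PInf_AE) auto
  then show ?thesis
  proof (rule AE_mp, intro AE_I2 impI)
    fix \<omega> assume "\<omega> \<in> space N" "(\<Sum>k. ennreal (Y k \<omega>)) \<noteq> \<infinity>"
    then show "summable (\<lambda>k. Y k \<omega>)" using nn by (intro summable_suminf_not_top) auto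
  qed
qed

text \<open>No integrability is given at time \<open>K\<close>, so the recursions are integrated
  over events \<open>A n\<close> of \<open>F K\<close> on which the data at time \<open>K\<close>
  are bounded by \<open>n\<close>. Such an event belongs to every later \<open>F k\<close>, hence
  all later conditional inequalities can be integrated over it. On each event
  \<open>energy_recursion_summable\<close> applies to the integrals, and the events cover the space
  up to a null set.\<close>

lemma AE_energy_summable:
  fixes M :: "'w measure" and Z Y S E \<Delta> :: "nat \<Rightarrow> 'w \<Rightarrow> real"
    and t dd \<delta> :: "nat \<Rightarrow> real" and d :: "nat \<Rightarrow> nat"
  assumes pm: "prob_space M" and fil: "filtration (space M) F" and sub: "\<And>k. subalgebra M (F k)"
    and mF: "\<And>k. Z k \<in> borel_measurable (F k)" "\<And>k. S k \<in> borel_measurable (F k)"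
    and mM: "\<And>k. Y k \<in> borel_measurable M" "\<And>k. E k \<in> borel_measurable M" "\<And>k. \<Delta> k \<in> borel_measurable M"
    and nn: "\<And>k \<omega>. \<omega> \<in> space M \<Longrightarrow> 0 \<le> Z k \<omega>" "\<And>k \<omega>. \<omega> \<in> space M \<Longrightarrow> 0 \<le> Y k \<omega>"
      "\<And>k \<omega>. \<omega> \<in> space M \<Longrightarrow> 0 \<le> S k \<omega>" "\<And>k \<omega>. \<omega> \<in> space M \<Longrightarrow> 0 \<le> E k \<omega>"
      "\<And>k \<omega>. \<omega> \<in> space M \<Longrightarrow> 0 \<le> \<Delta> k \<omega>"
    and step: "\<And>k \<omega>. \<omega> \<in> space M \<Longrightarrow> k \<ge> K \<Longrightarrow>
        Z (Suc k) \<omega> + Y k \<omega> + b * (t k)\<^sup>2 * S (Suc k) \<omega> \<le> Z k \<omega> + C0 * (t k)\<^sup>2 * E k \<omega>"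
    and err: "\<And>k. AE \<omega> in M. nn_cond_exp M (F k) (\<lambda>\<omega>. ennreal (E k \<omega>)) \<omega>
        \<le> nn_cond_exp M (F k) (\<lambda>\<omega>. ennreal (\<Delta> k \<omega>)) \<omega>"
    and rec: "\<And>k. AE \<omega> in M. nn_cond_exp M (F (Suc k)) (\<lambda>\<omega>. ennreal (\<Delta> (Suc k) \<omega>)) \<omega>
        \<le> ennreal ((1 - \<kappa>) * \<Delta> k \<omega> + (\<Sum>l = Suc k + 1 - d (Suc k)..Suc k. S l \<omega>) + dd (Suc k))"
    and d: "\<And>k. d k \<le> N" and KN: "N \<le> K" and K1: "K \<ge> 1"
    and tpos: "\<And>k. t k > 0"
    and t1: "\<And>k. k \<ge> K \<Longrightarrow> (1 - \<kappa>) * (t (Suc k))\<^sup>2 \<le> (1 - \<kappa> / 2) * (t k)\<^sup>2"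
    and t2: "\<And>k j. k \<ge> K \<Longrightarrow> j < N \<Longrightarrow> (t (Suc k))\<^sup>2 \<le> 2 * (t (k - j))\<^sup>2"
    and kap: "0 < \<kappa>" "\<kappa> \<le> 1" and C0: "C0 \<ge> 0" and b: "4 * real N * C0 / \<kappa> < b"
    and del: "summable \<delta>" "\<And>k. 0 \<le> \<delta> k" and dd: "\<And>k. 0 \<le> dd k" "\<And>k. (t k)\<^sup>2 * dd k \<le> 2 * \<delta> k"
  shows "AE \<omega> in M. summable (\<lambda>k. Y k \<omega>) \<and> summable (\<lambda>k. (t k)\<^sup>2 * E k \<omega>)"
proof -
  interpret prob_space M by (rule pm)
  have fms: "finite_measure_subalgebra M (F k)" for k
    using sub by unfold_locales auto
  have sfs: "sigma_finite_subalgebra M (F k)" for k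
    by (rule finite_measure_subalgebra_is_sigma_finite[OF fms])
  have mono: "A \<in> sets (F i) \<Longrightarrow> i \<le> j \<Longrightarrow> A \<in> sets (F j)" for A i j
    using filtration.sets_F_mono[OF fil, of i j] by auto
  have setsM: "A \<in> sets (F i) \<Longrightarrow> A \<in> sets M" for A i using sub[of i] by (auto simp: subalgebra_def)
  have spF: "space (F i) = space M" for i using sub[of i] by (simp add: subalgebra_def)
  have subF: "subalgebra (F j) (F i)" if "i \<le> j" for i j
    using mono that spF by (auto simp: subalgebra_def)
  have mMZ[measurable]: "Z k \<in> borel_measurable M" "S k \<in> borel_measurable M" for k
    using mF sub by (auto intro: measurable_from_subalg)
  note [measurable] = mM
  have bpos: "b > 0"
  proof -
    have "0 \<le> 4 * real N * C0 / \<kappa>" using kap C0 by simp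
    then show ?thesis using b by linarith
  qed
  define q where "q = nn_cond_exp M (F K) (\<lambda>\<omega>. ennreal (\<Delta> K \<omega>))"
  \<comment> \<open>\<open>\<Delta> K\<close> itself is only \<open>M\<close>-measurable, so the localization uses its conditional expectation.\<close>
  define A where "A n = {\<omega> \<in> space (F K). q \<omega> \<le> of_nat n \<and> Z K \<omega> \<le> real n \<and> (\<forall>l\<le>K. S l \<omega> \<le> real n)}" for n :: nat
  have An: "A n \<in> sets (F K)" for n
  proof -
    have [measurable]: "q \<in> borel_measurable (F K)" "Z K \<in> borel_measurable (F K)"
      unfolding q_def using mF by auto
    have [measurable]: "S l \<in> borel_measurable (F K)" if "l \<le> K" for l
      using measurable_from_subalg[OF subF[OF that] mF(2)] .
    have "{\<omega> \<in> space (F K). \<forall>l\<in>{..K}. S l \<omega> \<le> real n} \<in> sets (F K)"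
      by (intro sets.sets_Collect_finite_All) auto
    moreover have "{\<omega> \<in> space (F K). q \<omega> \<le> of_nat n \<and> Z K \<omega> \<le> real n} \<in> sets (F K)" by measurable
    moreover have "A n = {\<omega> \<in> space (F K). \<forall>l\<in>{..K}. S l \<omega> \<le> real n} \<inter> {\<omega> \<in> space (F K). q \<omega> \<le> of_nat n \<and> Z K \<omega> \<le> real n}"
      by (auto simp: A_def)
    ultimately show ?thesis by simp
  qed
  \<comment> \<open>The recursion bounds the conditional expectation by a real number. It is
    available at \<open>K\<close> because \<open>K \<ge> 1\<close> has a predecessor.\<close>
  have qfin: "AE \<omega> in M. q \<omega> < \<infinity>"
  proof -
    obtain K' where "K = Suc K'" using K1 by (cases K) auto
    then show ?thesis unfolding q_def using rec[of K'] by (auto elim!: eventually_mono simp: le_less_trans)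
  qed
  have local: "AE \<omega> in M. \<omega> \<in> A n \<longrightarrow> summable (\<lambda>k. Y (k + K) \<omega>) \<and> summable (\<lambda>k. (t (k + K))\<^sup>2 * E (k + K) \<omega>)" for n
  proof -
    \<comment> \<open>Restricting the measure turns integrals over \<open>A n\<close> into plain
      integrals with respect to a measure of total mass at most 1.\<close>
    define R where "R = restrict_space M (A n)"
    have AM: "A n \<in> sets M" by (rule setsM[OF An])
    have spR: "space R = A n" unfolding R_def using sets.sets_into_space[OF AM] by (auto simp: space_restrict_space)
    have inM: "\<omega> \<in> space M" if "\<omega> \<in> space R" for \<omega> using that sets.sets_into_space[OF AM] spR by auto
    have mR: "f \<in> borel_measurable R" if "f \<in> borel_measurable M" for f :: "'w \<Rightarrow> real"
      unfolding R_def by (rule measurable_restrict_space1[OF that])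
    have nnR: "(\<integral>\<^sup>+\<omega>. f \<omega> \<partial>R) = (\<integral>\<^sup>+\<omega>\<in>A n. f \<omega> \<partial>M)" for f
      unfolding R_def using AM by (intro nn_integral_restrict_space) auto
    interpret R: finite_measure R
      unfolding R_def by (rule finite_measure_restrict_space) (use AM in auto)
    have bounded: "integrable R f" if "f \<in> borel_measurable M" "\<And>\<omega>. \<omega> \<in> A n \<Longrightarrow> 0 \<le> f \<omega> \<and> f \<omega> \<le> real n" for f
      using that by (intro R.integrable_const_bound[of _ "real n"] mR) (auto simp: spR)
    have dom: "integrable R f" if "integrable R h" "f \<in> borel_measurable M" "\<And>\<omega>. \<omega> \<in> space R \<Longrightarrow> 0 \<le> f \<omega> \<and> f \<omega> \<le> h \<omega>"
      for f h :: "'w \<Rightarrow> real"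
      using that by (intro Bochner_Integration.integrable_bound[OF that(1)] mR) (auto intro!: AE_I2, fastforce)
    have AK: "A n \<in> sets (F k)" if "k \<ge> K" for k using mono[OF An that] .
    have Eint: "integrable R (E k)" "integral\<^sup>L R (E k) \<le> integral\<^sup>L R (\<Delta> k)" if "k \<ge> K" "integrable R (\<Delta> k)" for k
    proof -
      have le: "(\<integral>\<^sup>+\<omega>. ennreal (E k \<omega>) \<partial>R) \<le> (\<integral>\<^sup>+\<omega>. ennreal (\<Delta> k \<omega>) \<partial>R)"
        unfolding nnR
        by (intro sigma_finite_subalgebra.nn_set_integral_mono_nn_cond_exp[OF sfs AK[OF that(1)]] err) auto
      note * = integrable_if_nn_integral_le[OF mR[OF mM(2)] nn(4)[OF inM] that(2) nn(5)[OF inM] le]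
      show "integrable R (E k)" by (rule *(1))
      show "integral\<^sup>L R (E k) \<le> integral\<^sup>L R (\<Delta> k)" by (rule *(2))
    qed
    define rhs where "rhs k \<omega> = (1 - \<kappa>) * \<Delta> k \<omega> + (\<Sum>l = Suc k + 1 - d (Suc k)..Suc k. S l \<omega>) + dd (Suc k)" for k \<omega>
    have rhs0: "rhs k \<omega> \<ge> 0" if "\<omega> \<in> space M" for k \<omega>
      unfolding rhs_def using nn(3,5)[OF that] kap dd by (intro add_nonneg_nonneg sum_nonneg mult_nonneg_nonneg) auto
    have Dint: "integrable R (\<Delta> (Suc k))" "integral\<^sup>L R (\<Delta> (Suc k)) \<le> integral\<^sup>L R (rhs k)"
      if "k \<ge> K" "integrable R (rhs k)" for k
    proof -
      have le: "(\<integral>\<^sup>+\<omega>. ennreal (\<Delta> (Suc k) \<omega>) \<partial>R) \<le> (\<integral>\<^sup>+\<omega>. ennreal (rhs k \<omega>) \<partial>R)"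
        unfolding nnR rhs_def
        by (rule sigma_finite_subalgebra.nn_set_integral_le_if_nn_cond_exp_le[OF sfs AK[of "Suc k"] _ rec])
          (use that(1) in simp_all)
      note * = integrable_if_nn_integral_le[OF mR[OF mM(3)] nn(5)[OF inM] that(2) rhs0[OF inM] le]
      show "integrable R (\<Delta> (Suc k))" by (rule *(1))
      show "integral\<^sup>L R (\<Delta> (Suc k)) \<le> integral\<^sup>L R (rhs k)" by (rule *(2))
    qed
    have init: "integrable R (Z K)" "integrable R (\<Delta> K)" "\<And>l. l \<le> K \<Longrightarrow> integrable R (S l)"
    proof -
      show "integrable R (Z K)" "\<And>l. l \<le> K \<Longrightarrow> integrable R (S l)"
        using nn(1,3) by (auto intro!: bounded simp: A_def spF)
      have "(\<integral>\<^sup>+\<omega>. ennreal (\<Delta> K \<omega>) \<partial>R) \<le> (\<integral>\<^sup>+\<omega>\<in>A n. q \<omega> \<partial>M)"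
        unfolding nnR q_def
        by (rule sigma_finite_subalgebra.nn_set_integral_le_if_nn_cond_exp_le[OF sfs An]) auto
      also have "\<dots> \<le> (\<integral>\<^sup>+\<omega>\<in>A n. ennreal (real n) \<partial>M)"
        by (intro nn_integral_mono) (auto simp: A_def indicator_def ennreal_of_nat_eq_real_of_nat)
      finally have le: "(\<integral>\<^sup>+\<omega>. ennreal (\<Delta> K \<omega>) \<partial>R) \<le> (\<integral>\<^sup>+\<omega>. ennreal (real n) \<partial>R)" unfolding nnR .
      show "integrable R (\<Delta> K)"
        by (rule integrable_if_nn_integral_le(1)[OF mR[OF mM(3)] nn(5)[OF inM] _ _ le]) auto
    qed
    \<comment> \<open>All three nonnegative terms on the left of the energy inequality are dominated
      by its right-hand side, which is integrable once \<open>Z k\<close> and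
      \<open>\<Delta> k\<close> are.\<close>
    have next_int: "integrable R (Z (Suc k)) \<and> integrable R (Y k) \<and> integrable R (S (Suc k)) \<and> integrable R (E k)"
      if k: "k \<ge> K" and i: "integrable R (Z k)" "integrable R (\<Delta> k)" for k
    proof -
      have E: "integrable R (E k)" by (rule Eint(1)[OF k i(2)])
      have r: "integrable R (\<lambda>\<omega>. Z k \<omega> + C0 * (t k)\<^sup>2 * E k \<omega>)" using E i by auto
      have bt: "b * (t k)\<^sup>2 > 0" using bpos tpos[of k] by simp
      have lt: "0 \<le> Z (Suc k) \<omega> \<and> Z (Suc k) \<omega> \<le> Z k \<omega> + C0 * (t k)\<^sup>2 * E k \<omega>"
        "0 \<le> Y k \<omega> \<and> Y k \<omega> \<le> Z k \<omega> + C0 * (t k)\<^sup>2 * E k \<omega>"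
        "0 \<le> b * (t k)\<^sup>2 * S (Suc k) \<omega> \<and> b * (t k)\<^sup>2 * S (Suc k) \<omega> \<le> Z k \<omega> + C0 * (t k)\<^sup>2 * E k \<omega>"
        if "\<omega> \<in> space R" for \<omega>
      proof -
        note w = inM[OF that]
        have "0 \<le> b * (t k)\<^sup>2 * S (Suc k) \<omega>" by (rule mult_nonneg_nonneg[OF less_imp_le[OF bt] nn(3)[OF w]])
        then show "0 \<le> Z (Suc k) \<omega> \<and> Z (Suc k) \<omega> \<le> Z k \<omega> + C0 * (t k)\<^sup>2 * E k \<omega>"
        "0 \<le> Y k \<omega> \<and> Y k \<omega> \<le> Z k \<omega> + C0 * (t k)\<^sup>2 * E k \<omega>"
        "0 \<le> b * (t k)\<^sup>2 * S (Suc k) \<omega> \<and> b * (t k)\<^sup>2 * S (Suc k) \<omega> \<le> Z k \<omega> + C0 * (t k)\<^sup>2 * E k \<omega>"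
          using step[OF w k] nn(1)[OF w, of "Suc k"] nn(2)[OF w, of k] by linarith+
      qed
      have "integrable R (\<lambda>\<omega>. b * (t k)\<^sup>2 * S (Suc k) \<omega>)"
        by (rule dom[OF r]) (use lt(3) in auto)
      then have "integrable R (S (Suc k))"
        using less_imp_neq[OF bt] by (simp only: integrable_mult_left_iff) auto
      then show ?thesis using E dom[OF r mMZ(1) lt(1)] dom[OF r mM(1) lt(2)] by auto
    qed
    \<comment> \<open>Integrability propagates alternately: the energy inequality supplies
      \<open>Z (Suc k)\<close> and \<open>S (Suc k)\<close>, and the error recursion, whose window
      ends at \<open>Suc k\<close>, then supplies \<open>\<Delta> (Suc k)\<close>.\<close>
    have all: "integrable R (Z k) \<and> integrable R (\<Delta> k) \<and> (\<forall>l\<le>k. integrable R (S l))" if "k \<ge> K" for k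
      using that
    proof (induction k rule: dec_induct)
      case base then show ?case using init by auto
    next
      case (step k)
      note nx = next_int[OF step(1)]
      have S: "\<forall>l\<le>Suc k. integrable R (S l)" using step nx by (auto simp: le_Suc_eq)
      have "integrable R (rhs k)"
        unfolding rhs_def using S step.IH by (intro Bochner_Integration.integrable_add Bochner_Integration.integrable_sum) auto
      then show ?case using S nx step Dint(1) by auto
    qed
    have ints: "integrable R (Z k)" "integrable R (\<Delta> k)" "integrable R (Y k)" "integrable R (S (Suc k))" "integrable R (E k)"
      if "k \<ge> K" for k using all[OF that] next_int[OF that] by auto
    have intS: "integrable R (S k)" for k using all[of "max k K"] by auto
    let ?I = "\<lambda>f. integral\<^sup>L R f"
    \<comment> \<open>Integrability of \<open>Y k\<close> and \<open>E k\<close> is established from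
      \<open>K\<close> on only; setting the earlier values to 0 does not affect summability.\<close>
    define yy where "yy k = (if k \<ge> K then ?I (Y k) else 0)" for k
    define ee where "ee k = (if k \<ge> K then ?I (E k) else 0)" for k
    have pos: "?I f \<ge> 0" if "\<And>\<omega>. \<omega> \<in> space M \<Longrightarrow> 0 \<le> f \<omega>" for f :: "'w \<Rightarrow> real"
      using that inM by (intro integral_nonneg_AE) auto
    have seqs: "?I (Z (Suc k)) + yy k + b * (t k)\<^sup>2 * ?I (S (Suc k)) \<le> ?I (Z k) + C0 * (t k)\<^sup>2 * ee k"
      "ee k \<le> ?I (\<Delta> k)"
      "(t (Suc k))\<^sup>2 * ?I (\<Delta> (Suc k)) \<le> (1 - \<kappa>) * (t (Suc k))\<^sup>2 * ?I (\<Delta> k) + (t (Suc k))\<^sup>2 * (\<Sum>l = Suc k + 1 - d (Suc k)..Suc k. ?I (S l)) + 2 * \<delta> (Suc k)"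
      if k: "k \<ge> K" for k
    proof -
      have "?I (\<lambda>\<omega>. Z (Suc k) \<omega> + Y k \<omega> + b * (t k)\<^sup>2 * S (Suc k) \<omega>) \<le> ?I (\<lambda>\<omega>. Z k \<omega> + C0 * (t k)\<^sup>2 * E k \<omega>)"
        using ints[OF k] ints(1)[of "Suc k"] k step[OF inM k] by (intro integral_mono) auto
      then show "?I (Z (Suc k)) + yy k + b * (t k)\<^sup>2 * ?I (S (Suc k)) \<le> ?I (Z k) + C0 * (t k)\<^sup>2 * ee k"
        using ints[OF k] ints(1)[of "Suc k"] k by (simp add: yy_def ee_def)
      show "ee k \<le> ?I (\<Delta> k)" using Eint(2)[OF k] ints[OF k] k by (simp add: ee_def)
      have ri: "integrable R (rhs k)"
        unfolding rhs_def using intS ints[OF k] by (intro Bochner_Integration.integrable_add Bochner_Integration.integrable_sum) auto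
      have "?I (rhs k) = (1 - \<kappa>) * ?I (\<Delta> k) + (\<Sum>l = Suc k + 1 - d (Suc k)..Suc k. ?I (S l)) + measure R (space R) * dd (Suc k)"
        unfolding rhs_def using intS ints[OF k] by simp
      also have "measure R (space R) * dd (Suc k) \<le> 1 * dd (Suc k)"
      proof (rule mult_right_mono)
        have "measure R (space R) = measure M (A n)"
          unfolding spR unfolding R_def using AM by (intro measure_restrict_space) auto
        then show "measure R (space R) \<le> 1" by simp
      qed (rule dd)
      finally have "?I (\<Delta> (Suc k)) \<le> (1 - \<kappa>) * ?I (\<Delta> k) + (\<Sum>l = Suc k + 1 - d (Suc k)..Suc k. ?I (S l)) + dd (Suc k)"
        using Dint(2)[OF k ri] by linarith
      then have "(t (Suc k))\<^sup>2 * ?I (\<Delta> (Suc k)) \<le> (t (Suc k))\<^sup>2 * ((1 - \<kappa>) * ?I (\<Delta> k) + (\<Sum>l = Suc k + 1 - d (Suc k)..Suc k. ?I (S l)) + dd (Suc k))"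
        by (rule mult_left_mono) simp
      also have "\<dots> = (1 - \<kappa>) * (t (Suc k))\<^sup>2 * ?I (\<Delta> k) + (t (Suc k))\<^sup>2 * (\<Sum>l = Suc k + 1 - d (Suc k)..Suc k. ?I (S l)) + (t (Suc k))\<^sup>2 * dd (Suc k)"
        by (simp only: distrib_left mult_ac)
      finally show "(t (Suc k))\<^sup>2 * ?I (\<Delta> (Suc k)) \<le> (1 - \<kappa>) * (t (Suc k))\<^sup>2 * ?I (\<Delta> k) + (t (Suc k))\<^sup>2 * (\<Sum>l = Suc k + 1 - d (Suc k)..Suc k. ?I (S l)) + 2 * \<delta> (Suc k)"
        using dd(2)[of "Suc k"] by linarith
    qed
    have yy0: "0 \<le> yy k" and ee0: "0 \<le> ee k" for k
      unfolding yy_def ee_def using pos[OF nn(2)] pos[OF nn(4)] by simp_all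
    note se = energy_recursion_summable[of K "\<lambda>k. ?I (Z k)" yy "\<lambda>k. ?I (S k)" ee "\<lambda>k. ?I (\<Delta> k)",
        OF pos[OF nn(1)] yy0 pos[OF nn(3)] ee0 pos[OF nn(5)] del(2) seqs d KN K1 t1 t2 kap C0 b del(1)]
    have sums: "summable (\<lambda>k. ?I (Y (k + K)))" "summable (\<lambda>k. ?I (\<lambda>\<omega>. (t (k + K))\<^sup>2 * E (k + K) \<omega>))"
      using summable_ignore_initial_segment[OF se(1), of K] summable_ignore_initial_segment[OF se(2), of K]
      by (simp_all only: yy_def ee_def le_add2 if_True integral_mult_right_zero)
    have "AE \<omega> in R. summable (\<lambda>k. Y (k + K) \<omega>)"
      by (rule AE_summable_if_integrals_summable[OF ints(3) nn(2)[OF inM] sums(1)]) auto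
    moreover have "AE \<omega> in R. summable (\<lambda>k. (t (k + K))\<^sup>2 * E (k + K) \<omega>)"
      by (rule AE_summable_if_integrals_summable[OF _ _ sums(2)]) (use ints(5) nn(4)[OF inM] in auto)
    ultimately have "AE \<omega> in R. summable (\<lambda>k. Y (k + K) \<omega>) \<and> summable (\<lambda>k. (t (k + K))\<^sup>2 * E (k + K) \<omega>)"
      by eventually_elim simp
    then show ?thesis
      unfolding R_def by (rule AE_restrict_space_iff[THEN iffD1, rotated]) (use AM in auto)
  qed
  then have "AE \<omega> in M. \<forall>n. \<omega> \<in> A n \<longrightarrow> summable (\<lambda>k. Y (k + K) \<omega>) \<and> summable (\<lambda>k. (t (k + K))\<^sup>2 * E (k + K) \<omega>)"
    unfolding AE_all_countable by (rule allI)
  with qfin show ?thesis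
  proof (rule AE_mp[OF AE_conjI], intro AE_I2 impI)
    fix \<omega> assume w: "\<omega> \<in> space M"
      and h: "q \<omega> < \<infinity> \<and> (\<forall>n. \<omega> \<in> A n \<longrightarrow> summable (\<lambda>k. Y (k + K) \<omega>) \<and> summable (\<lambda>k. (t (k + K))\<^sup>2 * E (k + K) \<omega>))"
    \<comment> \<open>Every natural number \<open>n\<close> above \<open>B\<close> puts
      \<open>\<omega>\<close> into \<open>A n\<close>; \<open>enn2real\<close> loses nothing because
      \<open>q \<omega>\<close> is finite.\<close>
    define B where "B = max (enn2real (q \<omega>)) (max (Z K \<omega>) (\<Sum>l\<le>K. S l \<omega>))"
    obtain n :: nat where n: "B \<le> real n" using real_arch_simple by blast
    have "q \<omega> \<le> of_nat n"
    proof -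
      have "q \<omega> = ennreal (enn2real (q \<omega>))" using h by (simp add: less_top[symmetric])
      also have "\<dots> \<le> ennreal (real n)" using n by (intro ennreal_leI) (simp add: B_def)
      finally show ?thesis by (simp add: ennreal_of_nat_eq_real_of_nat)
    qed
    moreover have "S l \<omega> \<le> real n" if "l \<le> K" for l
    proof -
      have "S l \<omega> \<le> (\<Sum>l\<le>K. S l \<omega>)" using that nn(3)[OF w] by (intro member_le_sum) auto
      then show ?thesis using n by (simp add: B_def)
    qed
    ultimately have "\<omega> \<in> A n" using n w by (simp add: A_def B_def spF)
    then have "summable (\<lambda>k. Y (k + K) \<omega>)" "summable (\<lambda>k. (t (k + K))\<^sup>2 * E (k + K) \<omega>)" using h by auto
    then show "summable (\<lambda>k. Y k \<omega>) \<and> summable (\<lambda>k. (t k)\<^sup>2 * E k \<omega>)"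
      by (simp only: summable_iff_shift[of "\<lambda>k. Y k \<omega>" K] summable_iff_shift[of "\<lambda>k. (t k)\<^sup>2 * E k \<omega>" K])
  qed
qed

subsection \<open>One step of the scheme\<close>

text \<open>The bounds \<open>eta1\<close> and \<open>eta2\<close> are all that the energy estimate
  needs to know about the step size bound; \<open>\<rho>\<close> stands for the quotient
  \<open>\<Theta>' / \<beta>'\<close>.\<close>

locale afp_params =
  fixes s \<tau> \<gamma> \<eta> \<beta> \<Theta> \<rho> :: real
  assumes s1: "s > 1" and tau1: "\<tau> \<ge> 1" and gpos: "0 < \<gamma>" and g1: "\<gamma> \<le> 1"
    and sg: "s \<ge> 1 + 3 * \<gamma>" and etapos: "0 < \<eta>" and Thnn: "0 \<le> \<Theta>" and rhonn: "0 \<le> \<rho>"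
    and eta1: "\<eta> * (1 + \<tau>) + 7 / 3 * (1 + s - \<gamma>) * \<Theta> * \<eta> \<le> \<beta>"
    and eta2: "(1 + s - \<gamma>) * \<rho> * \<eta> \<le> 3 / 7"
begin

text \<open>The coefficient of \<open>Sinc\<close> in the energy decrease. It is small enough that
  \<open>eta2\<close> gives \<open>b * \<rho> \<le> 3 / 4\<close>, and large enough to exceed the
  threshold \<open>4 N (4 \<epsilon>) / \<kappa>\<close> of the summability argument.\<close>

definition "b = 7 / 4 * (1 + s - \<gamma>) * \<eta>"
definition "c = \<eta> / 2 * (s - 1 - \<gamma>)"
text \<open>
  The weight \<open>w\<close> makes the leading cross terms \<open>inner g (z - p)\<close> of \<open>Z\<close> cancel. The extra
  weight \<open>M0 / t\<close> decreases by about \<open>M0 / t\<^sup>2\<close> per step, which absorbs the multiples of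
  \<open>(norm (z - p))\<^sup>2 / t\<^sup>2\<close> left over by Young's inequality.
\<close>

definition "w = s\<^sup>2 * (s - 1) / (\<gamma> * \<eta>)"
text \<open>This value makes Young's inequality for the product of \<open>g' - g\<close> and
  \<open>e\<close> an exact balance:
  \<open>(\<eta> / 2)^2 = 4 (3 \<tau> \<eta> / 4) (2 \<epsilon>)\<close>.\<close>

definition "\<epsilon> = \<eta> / (24 * \<tau>)"
definition "M0 = 4 * (2 * s * (s - 1))\<^sup>2 / \<epsilon>"
text \<open>Chosen so that absorbing the product of \<open>g\<close> and \<open>e\<close> uses
  exactly a quarter of \<open>c t |g|^2\<close>.\<close>

definition "C1 = (\<eta> / 2 * (s - \<gamma>))\<^sup>2 / c"

lemma betapos: "\<beta> > 0"
proof -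
  have "\<eta> * (1 + \<tau>) > 0" using etapos tau1 by simp
  moreover have "7 / 3 * (1 + s - \<gamma>) * \<Theta> * \<eta> \<ge> 0" using etapos Thnn s1 g1 by simp
  ultimately show ?thesis using eta1 by linarith
qed

lemma cpos: "c > 0" unfolding c_def using etapos sg gpos by simp
lemma wpos: "w > 0" unfolding w_def using etapos s1 gpos by simp
lemma epspos: "\<epsilon> > 0" unfolding \<epsilon>_def using etapos tau1 by simp
lemma Mpos: "M0 > 0" unfolding M0_def using epspos s1 by simp
lemma bpos: "b > 0" unfolding b_def using etapos s1 g1 by simp

text \<open>The product of \<open>g' - g\<close> and \<open>y' - y\<close> is expanded in two ways:
  \<open>(t - s) (y' - y)\<close> is written through \<open>y' - z'\<close> and paired with
  \<open>g'\<close>, while \<open>t (y' - y)\<close> is written through \<open>y - z\<close> and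
  paired with \<open>g\<close>. The weights \<open>t\<close> and \<open>t - 1\<close> are one and
  the same weight at consecutive indices, as \<open>t\<close> grows by 1 per step.\<close>

lemma A_step:
  fixes y z y' z' x' g g' e :: "'a::real_inner"
  assumes t: "t > s" and ek: "ek = \<eta> * t / (2 * (t - s))"
    and x': "x' = y - ek *\<^sub>R (g + e)"
    and z': "z' = z + (\<gamma> / s) *\<^sub>R (x' - y)"
    and y': "y' = ((t - s) / t) *\<^sub>R x' + (s / t) *\<^sub>R z'"
  shows "s * t * inner g' (y' - z') + \<eta> / 4 * t\<^sup>2 * (norm g')\<^sup>2 =
     s * (t - 1) * inner g (y - z) + \<eta> / 4 * (t - 1)\<^sup>2 * (norm g)\<^sup>2
     - s * (s - 1) * inner g (y - z) - (c * t + \<eta> / 4) * (norm g)\<^sup>2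
     - t * (t - s) * inner (g' - g) (y' - y) + \<eta> / 4 * t\<^sup>2 * (norm (g' - g))\<^sup>2
     - \<eta> / 2 * t\<^sup>2 * inner (g' - g) e - \<eta> / 2 * t * (s - \<gamma>) * inner g e"
proof -
  have tp: "t > 0" using t s1 by simp
  \<comment> \<open>This substitution clears the fractions in \<eta> from the concluding polynomial
    identity.\<close>
  obtain \<mu> where eta: "\<eta> = 4 * \<mu>" using that[of "\<eta> / 4"] by simp
  have ek2: "ek * (t - s) = \<eta> * t / 2" using t by (simp add: ek field_simps)
  have ty: "t *\<^sub>R y' = (t - s) *\<^sub>R x' + s *\<^sub>R z'"
    using tp by (simp add: y' scaleR_add_right)
  have sz: "s *\<^sub>R z' = s *\<^sub>R z - (\<gamma> * ek) *\<^sub>R (g + e)"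
    using s1 by (simp add: z' x' scaleR_add_right scaleR_diff_right)
  have p2: "t *\<^sub>R (y' - y) = - (s *\<^sub>R (y - z)) - (\<eta> * t / 2 + \<gamma> * ek) *\<^sub>R (g + e)"
    unfolding scaleR_diff_right[of t] ty sz ek2[symmetric] x' by (simp add: algebra_simps)
  have p1: "(t - s) *\<^sub>R (y' - y) = - (s *\<^sub>R (y' - z')) - (\<eta> * t / 2) *\<^sub>R (g + e)"
  proof -
    have "(t - s) *\<^sub>R (y' - y) = t *\<^sub>R y' - s *\<^sub>R y' - (t - s) *\<^sub>R y"
      by (simp add: algebra_simps)
    also have "\<dots> = - (s *\<^sub>R (y' - z')) - (\<eta> * t / 2) *\<^sub>R (g + e)"
      unfolding ty ek2[symmetric] x' by (simp add: algebra_simps)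
    finally show ?thesis .
  qed
  have "t * (t - s) * inner (g' - g) (y' - y)
      = t * inner g' ((t - s) *\<^sub>R (y' - y)) - (t - s) * inner g (t *\<^sub>R (y' - y))"
    by (simp add: algebra_simps inner_diff_left)
  also have "\<dots> = - s * t * inner g' (y' - z') - 2 * \<mu> * t\<^sup>2 * (inner g' g + inner g' e)
       + s * (t - s) * inner g (y - z) + (2 * \<mu> * t * (t - s) + \<gamma> * (ek * (t - s))) * (inner g g + inner g e)"
    unfolding p1 p2 eta
    by (simp add: inner_diff_right inner_minus_right inner_add_right power2_eq_square algebra_simps)
  also have "ek * (t - s) = 2 * \<mu> * t" using ek2 eta by simp
  finally have q: "t * (t - s) * inner (g' - g) (y' - y)
    = - s * t * inner g' (y' - z') - 2 * \<mu> * t\<^sup>2 * (inner g' g + inner g' e)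
       + s * (t - s) * inner g (y - z) + (2 * \<mu> * t * (t - s) + \<gamma> * (2 * \<mu> * t)) * (inner g g + inner g e)" .
  have nh: "(norm (g' - g))\<^sup>2 = inner g' g' - 2 * inner g' g + inner g g"
    unfolding power2_norm_eq_inner by (simp add: inner_diff_left inner_diff_right inner_commute)
  have ih: "inner (g' - g) e = inner g' e - inner g e" by (simp add: inner_diff_left)
  have k: "c = 2 * \<mu> * (s - 1 - \<gamma>)" "\<eta> / 4 = \<mu>" "\<eta> / 2 = 2 * \<mu>"
    unfolding c_def by (simp_all add: eta)
  show ?thesis
    unfolding q k nh ih power2_norm_eq_inner[of g] power2_norm_eq_inner[of g']
    by (simp add: power2_eq_square algebra_simps)
qed

text \<open>
  \<open>inner h dy - \<beta> * (norm h)\<^sup>2\<close> is a measurable upper bound of \<open>\<beta>' * D\<close>; with \<open>\<rho> = \<Theta>' / \<beta>'\<close> it replaces the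
  possibly nonmeasurable \<open>\<Theta>' * D\<close> of the error condition.
\<close>

definition Sinc :: "'a::real_inner \<Rightarrow> 'a \<Rightarrow> real" where
  "Sinc h dy = \<Theta> * (norm h)\<^sup>2 + \<rho> * (inner h dy - \<beta> * (norm h)\<^sup>2)"

text \<open>Young's inequality splits the two products with \<open>e\<close> in the identity for
  \<open>A\<close>. The co-coercivity term \<open>t (t - s) inner (g' - g) (y' - y)\<close> must
  then pay both for the resulting multiple of \<open>|g' - g|^2\<close> and for
  \<open>Sinc\<close>.\<close>

lemma A_step_le:
  fixes y z y' z' x' g g' e :: "'a::real_inner"
  assumes t: "t \<ge> 8 * s" and ek: "ek = \<eta> * t / (2 * (t - s))"
    and x': "x' = y - ek *\<^sub>R (g + e)"
    and z': "z' = z + (\<gamma> / s) *\<^sub>R (x' - y)"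
    and y': "y' = ((t - s) / t) *\<^sub>R x' + (s / t) *\<^sub>R z'"
    and coco: "inner (g' - g) (y' - y) \<ge> \<beta> * (norm (g' - g))\<^sup>2"
  shows "s * t * inner g' (y' - z') + \<eta> / 4 * t\<^sup>2 * (norm g')\<^sup>2 \<le>
     s * (t - 1) * inner g (y - z) + \<eta> / 4 * (t - 1)\<^sup>2 * (norm g)\<^sup>2
     - s * (s - 1) * inner g (y - z) - 3 / 4 * c * t * (norm g)\<^sup>2
     - b * t\<^sup>2 * Sinc (g' - g) (y' - y) + (2 * \<epsilon> * t\<^sup>2 + C1 * t) * (norm e)\<^sup>2"
proof -
  define h where "h = g' - g"
  define D where "D = inner h (y' - y) - \<beta> * (norm h)\<^sup>2"
  have D0: "D \<ge> 0" using coco by (simp add: D_def h_def)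
  have tp: "t > 0" "t > s" using t s1 by auto
  have 1: "- (\<eta> / 2 * t\<^sup>2 * inner h e) \<le> \<eta> * t\<^sup>2 * (3 * \<tau> / 4) * (norm h)\<^sup>2 + 2 * \<epsilon> * t\<^sup>2 * (norm e)\<^sup>2"
  proof -
    have "- (\<eta> / 2 * t\<^sup>2 * inner h e) = (\<eta> / 2 * t\<^sup>2) * (- inner h e)" by simp
    also have "\<dots> \<le> (\<eta> / 2 * t\<^sup>2) * (norm h * norm e)"
      using norm_cauchy_schwarz[of "-h" e] etapos by (intro mult_left_mono) auto
    also have "\<dots> = (\<eta> / 2 * t\<^sup>2) * norm h * norm e" by simp
    also have "\<dots> \<le> \<eta> * t\<^sup>2 * (3 * \<tau> / 4) * (norm h)\<^sup>2 + 2 * \<epsilon> * t\<^sup>2 * (norm e)\<^sup>2"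
      using etapos tau1 tp
      by (intro Young_ineq) (auto simp: \<epsilon>_def power2_eq_square field_simps)
    finally show ?thesis .
  qed
  have 2: "- (\<eta> / 2 * t * (s - \<gamma>) * inner g e) \<le> c * t / 4 * (norm g)\<^sup>2 + C1 * t * (norm e)\<^sup>2"
  proof -
    have "- (\<eta> / 2 * t * (s - \<gamma>) * inner g e) = (\<eta> / 2 * t * (s - \<gamma>)) * (- inner g e)" by simp
    also have "\<dots> \<le> (\<eta> / 2 * t * (s - \<gamma>)) * (norm g * norm e)"
      using norm_cauchy_schwarz[of "-g" e] etapos tp sg gpos by (intro mult_left_mono) auto
    also have "\<dots> = (\<eta> / 2 * t * (s - \<gamma>)) * norm g * norm e" by simp
    also have "\<dots> \<le> c * t / 4 * (norm g)\<^sup>2 + C1 * t * (norm e)\<^sup>2"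
    proof (intro Young_ineq)
      show "(\<eta> / 2 * t * (s - \<gamma>))\<^sup>2 \<le> 4 * (c * t / 4) * (C1 * t)"
        using cpos by (simp add: C1_def power2_eq_square)
    qed (use cpos tp in auto)
    finally show ?thesis .
  qed
  \<comment> \<open>With \<open>h = g' - g\<close>, the pairing of \<open>h\<close> and
    \<open>y' - y\<close> equals \<open>D + \<beta> |h|^2\<close>. Since \<open>t \<ge> 8 s\<close>,
    its factor is at least \<open>(7/8) t^2\<close>: the part with \<open>D\<close> covers
    \<open>b * \<rho> * D\<close>, and \<open>eta1\<close> lets the other part cover all multiples
    of \<open>|h|^2\<close>.\<close>
  have 3: "- (t * (t - s) * inner h (y' - y)) + (\<eta> / 4 * t\<^sup>2 + \<eta> * t\<^sup>2 * (3 * \<tau> / 4)) * (norm h)\<^sup>2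
     \<le> - (b * t\<^sup>2 * Sinc h (y' - y))"
  proof -
    have S: "Sinc h (y' - y) = \<Theta> * (norm h)\<^sup>2 + \<rho> * D" by (simp add: Sinc_def D_def)
    have I: "inner h (y' - y) = D + \<beta> * (norm h)\<^sup>2" by (simp add: D_def)
    have ts: "t * (t - s) \<ge> 7 / 8 * t\<^sup>2"
    proof -
      have "t * (t - s) \<ge> t * (7 / 8 * t)" using t tp by (intro mult_left_mono) auto
      then show ?thesis by (simp add: power2_eq_square)
    qed
    have br: "b * \<rho> \<le> 7 / 8" unfolding b_def using eta2 by (simp add: algebra_simps)
    have "(b * \<rho>) * t\<^sup>2 \<le> 7 / 8 * t\<^sup>2" using br by (intro mult_right_mono) auto
    then have d1: "(b * \<rho>) * t\<^sup>2 \<le> t * (t - s)" using ts by linarith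
    have "\<eta> / 4 + \<eta> * (3 * \<tau> / 4) + b * \<Theta> \<le> 3 / 4 * (\<eta> * (1 + \<tau>) + 7 / 3 * (1 + s - \<gamma>) * \<Theta> * \<eta>)"
    proof -
      define k where "k = (1 + s - \<gamma>) * \<Theta> * \<eta>"
      have e: "b * \<Theta> = 7 / 4 * k" "7 / 3 * (1 + s - \<gamma>) * \<Theta> * \<eta> = 7 / 3 * k"
        by (simp_all add: b_def k_def)
      show ?thesis unfolding e using etapos by (simp add: algebra_simps)
    qed
    also have "\<dots> \<le> 3 / 4 * \<beta>" using eta1 by simp
    also have "\<dots> \<le> 7 / 8 * \<beta>" using betapos by simp
    finally have "(\<eta> / 4 + \<eta> * (3 * \<tau> / 4) + b * \<Theta>) * t\<^sup>2 \<le> (7 / 8 * \<beta>) * t\<^sup>2"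
      by (intro mult_right_mono) auto
    also have "\<dots> \<le> t * (t - s) * \<beta>" using mult_right_mono[OF ts, of \<beta>] betapos
      by (simp add: algebra_simps)
    finally have d2: "(\<eta> / 4 + \<eta> * (3 * \<tau> / 4) + b * \<Theta>) * t\<^sup>2 \<le> t * (t - s) * \<beta>" .
    have "(b * \<rho>) * t\<^sup>2 * D \<le> t * (t - s) * D" using d1 D0 by (rule mult_right_mono)
    moreover have "(\<eta> / 4 + \<eta> * (3 * \<tau> / 4) + b * \<Theta>) * t\<^sup>2 * (norm h)\<^sup>2 \<le> t * (t - s) * \<beta> * (norm h)\<^sup>2"
      using d2 by (rule mult_right_mono) simp
    ultimately show ?thesis unfolding S I by (simp add: algebra_simps)
  qed
  have 4: "\<eta> / 4 * (norm g)\<^sup>2 \<ge> 0" using etapos by simp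
  show ?thesis
    unfolding A_step[OF tp(2) ek x' z' y', of g'] h_def[symmetric]
    using 1 2 3 4 by (simp add: algebra_simps)
qed

text \<open>In the estimate of the remainder, \<open>m0 / t\<close> bounds the cross coefficient
  that the choice of \<open>w\<close> leaves uncancelled, and \<open>R2\<close> bounds the
  second-order factor \<open>W r^2\<close>.\<close>

definition "m0 = 2 * s\<^sup>2 * (s - 1) + 2 * (\<gamma> * \<eta> / s) * M0"
definition "R2 = 2 * s * (s - 1) * (\<gamma> * \<eta> / s)"
text \<open>The entry \<open>8 * s\<close> makes \<open>t - s\<close> at least
  \<open>(7/8) t\<close>; the other entries are the thresholds for the estimates in
  \<open>remainder_le\<close>.\<close>

definition "T = Max {8 * s, 2, M0 / w, 4 * m0\<^sup>2 / (c * M0), 8 * R2 / c, (2 * R2 + C1) / \<epsilon>}"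

lemma T_ge:
  assumes "t \<ge> T"
  shows "t \<ge> 8 * s" "t \<ge> 2" "t \<ge> M0 / w" "t \<ge> 4 * m0\<^sup>2 / (c * M0)" "t \<ge> 8 * R2 / c"
    "t \<ge> (2 * R2 + C1) / \<epsilon>"
  using assms unfolding T_def by simp_all

text \<open>Here \<open>u\<close> is the distance of \<open>z\<close> to a zero and \<open>r\<close>
  the length factor in \<open>z' = z - r (g + e)\<close>. The cross coefficient of \<open>g\<close>
  and \<open>u\<close> is only \<open>O(1 / t)\<close>, so Young's inequality absorbs it into
  \<open>c t g^2\<close> and the drop of \<open>M0 / t\<close>; the remaining terms have lower order
  than their budgets.\<close>

lemma remainder_le:
  fixes g u e :: real
  assumes tT: "t \<ge> T" and r: "r = \<gamma> * (\<eta> * t / (2 * (t - s))) / s"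
    and nn: "g \<ge> 0" "u \<ge> 0" "e \<ge> 0"
  shows "\<bar>2 * r * (w + M0 / (t + 1)) - s * (s - 1)\<bar> * g * u + 2 * r * (w + M0 / (t + 1)) * e * u
      + 2 * (w + M0 / (t + 1)) * r\<^sup>2 * (g\<^sup>2 + e\<^sup>2) + C1 * t * e\<^sup>2
    \<le> c / 2 * t * g\<^sup>2 + 2 * \<epsilon> * t\<^sup>2 * e\<^sup>2 + (M0 / t - M0 / (t + 1)) * u\<^sup>2"
proof -
  note T = T_ge[OF tT]
  have tp: "t > 0" "t > 1" using T by auto
  have t2s: "t - s \<ge> t / 2" and ts0: "t - s > 0" using T(1) s1 by auto
  define W where "W = w + M0 / (t + 1)"
  have W0: "W \<ge> 0" unfolding W_def using wpos Mpos tp by simp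
  have r0: "r \<ge> 0" unfolding r using gpos etapos s1 ts0 tp by simp
  have half: "t / (2 * (t - s)) \<le> 1" using t2s ts0 by (simp add: field_simps)
  have rle: "r \<le> \<gamma> * \<eta> / s"
  proof -
    have "r = (\<gamma> * \<eta> / s) * (t / (2 * (t - s)))" unfolding r by (simp add: mult_ac)
    also have "\<dots> \<le> (\<gamma> * \<eta> / s) * 1" using half gpos etapos s1 by (intro mult_left_mono) auto
    finally show ?thesis by simp
  qed
  have W2: "W \<le> 2 * w"
  proof -
    have "M0 / (t + 1) \<le> M0 / t" using Mpos tp by (simp add: frac_le)
    also have "\<dots> \<le> w" using T(3) wpos tp by (simp add: field_simps)
    finally show ?thesis by (simp add: W_def)
  qed
  have rW: "r * W \<le> 2 * s * (s - 1)"
  proof -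
    have "r * W \<le> (\<gamma> * \<eta> / s) * (2 * w)"
      using rle W2 r0 W0 gpos etapos s1 by (intro mult_mono) auto
    also have "\<dots> = 2 * s * (s - 1)" unfolding w_def using gpos etapos s1
      by (simp add: power2_eq_square)
    finally show ?thesis .
  qed
  have Wr2: "W * r\<^sup>2 \<le> R2"
  proof -
    have "W * r\<^sup>2 = (r * W) * r" by (simp add: power2_eq_square)
    also have "\<dots> \<le> R2" unfolding R2_def
      using mult_mono[OF rW rle] r0 s1 by simp
    finally show ?thesis .
  qed
  define m where "m = 2 * r * W - s * (s - 1)"
  \<comment> \<open>The choice of \<open>w\<close> gives
    \<open>2 r w = s (s - 1) t / (t - s)\<close>, so the leading term \<open>s (s - 1)\<close>
    cancels exactly.\<close>
  have m: "m = s\<^sup>2 * (s - 1) / (t - s) + 2 * r * (M0 / (t + 1))"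
  proof -
    have "2 * r * w = s * (s - 1) * (t / (t - s))"
      unfolding r w_def using gpos etapos s1 ts0 by (simp add: power2_eq_square field_simps)
    also have "t / (t - s) = 1 + s / (t - s)" using ts0 by (simp add: field_simps)
    finally show ?thesis unfolding m_def W_def by (simp add: algebra_simps power2_eq_square)
  qed
  have m_nn: "m \<ge> 0" unfolding m using s1 ts0 r0 Mpos tp by simp
  have m_le: "m \<le> m0 / t"
  proof -
    have "s\<^sup>2 * (s - 1) / (t - s) \<le> s\<^sup>2 * (s - 1) / (t / 2)"
      using t2s tp s1 by (intro divide_left_mono) auto
    moreover have "2 * r * (M0 / (t + 1)) \<le> 2 * (\<gamma> * \<eta> / s) * (M0 / t)"
      using rle r0 Mpos tp gpos etapos s1 by (intro mult_mono frac_le) auto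
    ultimately show ?thesis unfolding m m0_def add_divide_distrib by (simp add: mult_ac)
  qed
  \<comment> \<open>The drop of the weight is split into two equal parts
    \<open>M0 / (4 t^2)\<close>, one for each cross product with \<open>u\<close>.\<close>
  have Mt: "M0 / t - M0 / (t + 1) \<ge> M0 / (2 * t\<^sup>2)"
  proof -
    have "M0 / t - M0 / (t + 1) = M0 / (t * (t + 1))" using tp by (simp add: field_simps)
    also have "\<dots> \<ge> M0 / (2 * t\<^sup>2)"
      using tp Mpos by (intro divide_left_mono) (auto simp: power2_eq_square intro!: mult_left_mono mult_pos_pos)
    finally show ?thesis .
  qed
  have a1: "m * g * u \<le> c * t / 4 * g\<^sup>2 + M0 / (4 * t\<^sup>2) * u\<^sup>2"
  proof (intro Young_ineq)
    have "m\<^sup>2 \<le> (m0 / t)\<^sup>2" using m_le m_nn by (intro power_mono)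
    also have "\<dots> = m0\<^sup>2 / t\<^sup>2" by (simp add: power_divide)
    also have "\<dots> \<le> (c * M0 * t / 4) / t\<^sup>2"
      using T(4) cpos Mpos by (intro divide_right_mono) (auto simp: field_simps)
    also have "\<dots> = 4 * (c * t / 4) * (M0 / (4 * t\<^sup>2))" by simp
    finally show "m\<^sup>2 \<le> 4 * (c * t / 4) * (M0 / (4 * t\<^sup>2))" .
  qed (use cpos tp in simp)
  have a2: "2 * r * W * e * u \<le> \<epsilon> * t\<^sup>2 * e\<^sup>2 + M0 / (4 * t\<^sup>2) * u\<^sup>2"
  proof (intro Young_ineq)
    have "(2 * r * W)\<^sup>2 = 4 * (r * W)\<^sup>2" by (simp add: power2_eq_square)
    also have "\<dots> \<le> 4 * (2 * s * (s - 1))\<^sup>2" using rW r0 W0 by (intro mult_left_mono power_mono) auto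
    also have "\<dots> = 4 * (\<epsilon> * t\<^sup>2) * (M0 / (4 * t\<^sup>2))"
      unfolding M0_def using epspos tp by simp
    finally show "(2 * r * W)\<^sup>2 \<le> 4 * (\<epsilon> * t\<^sup>2) * (M0 / (4 * t\<^sup>2))" .
  qed (use epspos tp in simp)
  have a3: "2 * W * r\<^sup>2 * g\<^sup>2 \<le> c / 4 * t * g\<^sup>2"
    using Wr2 T(5) cpos by (intro mult_right_mono) (auto simp: field_simps)
  have a4: "(2 * W * r\<^sup>2 + C1 * t) * e\<^sup>2 \<le> \<epsilon> * t\<^sup>2 * e\<^sup>2"
  proof (intro mult_right_mono)
    have "R2 \<ge> 0" unfolding R2_def using s1 gpos etapos by simp
    have "2 * W * r\<^sup>2 + C1 * t \<le> 2 * R2 * 1 + C1 * t" using Wr2 by simp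
    also have "\<dots> \<le> (2 * R2 + C1) * t"
      using tp \<open>R2 \<ge> 0\<close> by (simp add: algebra_simps mult_le_cancel_right1)
    also have "\<dots> \<le> (\<epsilon> * t) * t"
      using T(6) epspos tp by (intro mult_right_mono) (auto simp: field_simps)
    finally show "2 * W * r\<^sup>2 + C1 * t \<le> \<epsilon> * t\<^sup>2" by (simp add: power2_eq_square)
  qed simp
  have a5: "M0 / (2 * t\<^sup>2) * u\<^sup>2 \<le> (M0 / t - M0 / (t + 1)) * u\<^sup>2"
    using Mt by (intro mult_right_mono) auto
  have a6: "M0 / (4 * t\<^sup>2) * u\<^sup>2 + M0 / (4 * t\<^sup>2) * u\<^sup>2 = M0 / (2 * t\<^sup>2) * u\<^sup>2" by simp
  have d: "2 * W * r\<^sup>2 * (g\<^sup>2 + e\<^sup>2) + C1 * t * e\<^sup>2 = 2 * W * r\<^sup>2 * g\<^sup>2 + (2 * W * r\<^sup>2 + C1 * t) * e\<^sup>2"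
    "c / 2 * t * g\<^sup>2 = c * t / 4 * g\<^sup>2 + c / 4 * t * g\<^sup>2"
    by (simp_all add: ring_distribs)
  have abs: "\<bar>2 * r * W - s * (s - 1)\<bar> = m"
    using m_nn by (simp add: m_def)
  show ?thesis
    unfolding W_def[symmetric] abs
    using a1 a2 a3 a4 a5 a6 d by linarith
qed

text \<open>Monotonicity at \<open>xo\<close> turns \<open>- s (s - 1) inner g (y - z)\<close> into
  at most \<open>s (s - 1) inner g (z - xo)\<close>. Expanding the new squared distance produces a
  cross term of opposite sign, and \<open>remainder_le\<close> pays for the difference with
  \<open>(c / 2) t |g|^2\<close> and another \<open>2 \<epsilon> t^2 |e|^2\<close>.\<close>

lemma Z_step:
  fixes y z y' z' x' g g' e xo :: "'a::real_inner"
  assumes t: "t \<ge> T" and ek: "ek = \<eta> * t / (2 * (t - s))"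
    and x': "x' = y - ek *\<^sub>R (g + e)"
    and z': "z' = z + (\<gamma> / s) *\<^sub>R (x' - y)"
    and y': "y' = ((t - s) / t) *\<^sub>R x' + (s / t) *\<^sub>R z'"
    and coco: "inner (g' - g) (y' - y) \<ge> \<beta> * (norm (g' - g))\<^sup>2"
    and mon: "inner g (y - xo) \<ge> 0"
  shows "s * t * inner g' (y' - z') + \<eta> / 4 * t\<^sup>2 * (norm g')\<^sup>2
      + (w + M0 / (t + 1)) * (norm (z' - xo))\<^sup>2
      + c / 4 * t * (norm g)\<^sup>2 + b * t\<^sup>2 * Sinc (g' - g) (y' - y)
    \<le> s * (t - 1) * inner g (y - z) + \<eta> / 4 * (t - 1)\<^sup>2 * (norm g)\<^sup>2
      + (w + M0 / t) * (norm (z - xo))\<^sup>2 + 4 * \<epsilon> * t\<^sup>2 * (norm e)\<^sup>2"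
proof -
  define r where "r = \<gamma> * (\<eta> * t / (2 * (t - s))) / s"
  define W where "W = w + M0 / (t + 1)"
  define u where "u = z - xo"
  have tp: "t > 0" using T_ge[OF t] by simp
  have W0: "W \<ge> 0" unfolding W_def using wpos Mpos tp by simp
  have r0: "r \<ge> 0" unfolding r_def using gpos etapos s1 T_ge(1)[OF t] tp by simp
  have u': "z' - xo = u - r *\<^sub>R (g + e)"
    unfolding z' x' u_def r_def ek by (simp add: algebra_simps)
  have nu: "(norm (z' - xo))\<^sup>2 = (norm u)\<^sup>2 - 2 * r * (inner g u + inner e u) + r\<^sup>2 * (norm (g + e))\<^sup>2"
  proof -
    define p where "p = g + e"
    have "(norm (u - r *\<^sub>R p))\<^sup>2 = (norm u)\<^sup>2 - 2 * r * inner p u + r\<^sup>2 * (norm p)\<^sup>2"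
      unfolding power2_norm_eq_inner
      by (simp add: inner_diff_left inner_diff_right inner_commute[of u p] power2_eq_square algebra_simps)
    then show ?thesis unfolding u' p_def by (simp add: inner_add_left)
  qed
  have ge: "(norm (g + e))\<^sup>2 \<le> 2 * ((norm g)\<^sup>2 + (norm e)\<^sup>2)" by (rule norm_add_square_le)
  have 1: "W * r\<^sup>2 * (norm (g + e))\<^sup>2 \<le> 2 * W * r\<^sup>2 * ((norm g)\<^sup>2 + (norm e)\<^sup>2)"
    using mult_left_mono[OF ge, of "W * r\<^sup>2"] W0 by (simp add: algebra_simps)
  have 2: "- (2 * r * W * inner e u) \<le> 2 * r * W * norm e * norm u"
  proof -
    have "(2 * r * W) * (- inner e u) \<le> (2 * r * W) * (norm e * norm u)"
      using norm_cauchy_schwarz[of "-e" u] r0 W0 by (intro mult_left_mono) auto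
    then show ?thesis by simp
  qed
  have 3: "(s * (s - 1) - 2 * r * W) * inner g u \<le> \<bar>2 * r * W - s * (s - 1)\<bar> * norm g * norm u"
  proof -
    have "(s * (s - 1) - 2 * r * W) * inner g u \<le> \<bar>s * (s - 1) - 2 * r * W\<bar> * \<bar>inner g u\<bar>"
      by (metis abs_ge_self abs_mult)
    also have "\<dots> \<le> \<bar>s * (s - 1) - 2 * r * W\<bar> * (norm g * norm u)"
      by (intro mult_left_mono Cauchy_Schwarz_ineq2) auto
    finally show ?thesis by (simp add: abs_minus_commute)
  qed
  have 4: "- (s * (s - 1) * inner g (y - z)) \<le> s * (s - 1) * inner g u"
  proof -
    have "inner g (y - z) = inner g (y - xo) - inner g u" by (simp add: u_def inner_diff_right)
    then have "s * (s - 1) * inner g (y - z) = s * (s - 1) * inner g (y - xo) - s * (s - 1) * inner g u"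
      by (simp only: right_diff_distrib)
    moreover have "s * (s - 1) * inner g (y - xo) \<ge> 0" using s1 mon by simp
    ultimately show ?thesis by linarith
  qed
  note A = A_step_le[OF T_ge(1)[OF t] ek x' z' y' coco]
  note R = remainder_le[OF t r_def norm_ge_zero[of g] norm_ge_zero[of u] norm_ge_zero[of e]]
  have zz: "W * (norm (z' - xo))\<^sup>2 = W * (norm u)\<^sup>2 - 2 * r * W * inner g u - 2 * r * W * inner e u
      + W * r\<^sup>2 * (norm (g + e))\<^sup>2"
    unfolding nu by (simp add: algebra_simps)
  have d: "(w + M0 / t) * (norm u)\<^sup>2 = W * (norm u)\<^sup>2 + (M0 / t - M0 / (t + 1)) * (norm u)\<^sup>2"
    "(2 * \<epsilon> * t\<^sup>2 + C1 * t) * (norm e)\<^sup>2 = 2 * \<epsilon> * t\<^sup>2 * (norm e)\<^sup>2 + C1 * t * (norm e)\<^sup>2"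
    "(s * (s - 1) - 2 * r * W) * inner g u = s * (s - 1) * inner g u - 2 * r * W * inner g u"
    by (simp_all add: W_def ring_distribs)
  show ?thesis
    unfolding W_def[symmetric] u_def[symmetric]
    using A R[folded W_def] zz 1 2 3 4 d by linarith
qed

lemma eventually_weights:
  assumes t: "\<And>k. t k = real k + 3 * s + \<tau>" and kap: "0 < \<kappa>" "\<kappa> \<le> 1" and N: "real N \<le> \<tau>"
  obtains K where "K \<ge> 1" "N \<le> K" "\<And>k. k \<ge> K \<Longrightarrow> t k \<ge> T"
    "\<And>k. k \<ge> K \<Longrightarrow> (1 - \<kappa>) * (t (Suc k))\<^sup>2 \<le> (1 - \<kappa> / 2) * (t k)\<^sup>2"
    "\<And>k j. k \<ge> K \<Longrightarrow> j < N \<Longrightarrow> (t (Suc k))\<^sup>2 \<le> 2 * (t (k - j))\<^sup>2"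
proof -
  \<comment> \<open>The term \<open>6 / \<kappa>\<close> ensures
    \<open>3 t \<le> (\<kappa> / 2) t^2\<close>, and \<open>4 * \<tau> + 4\<close> ensures
    \<open>3 (t + 1) \<le> 4 (t - \<tau>)\<close>, whence a squared weight ratio of at most
    \<open>16 / 9 \<le> 2\<close>.\<close>
  define L where "L = \<bar>T\<bar> + 6 / \<kappa> + 4 * \<tau> + 4"
  define K where "K = nat \<lceil>L\<rceil>"
  have k0: "6 / \<kappa> > 0" using kap by simp
  have K: "L \<le> real k" if "k \<ge> K" for k using that unfolding K_def by linarith
  have bnd: "real k \<ge> T" "real k \<ge> 6 / \<kappa>" "real k \<ge> 4 * \<tau> + 4" if "k \<ge> K" for k
    using K[OF that] k0 tau1 unfolding L_def by linarith+
  have tk: "t k \<ge> real k" for k using s1 tau1 by (simp add: t)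
  show thesis
  proof (rule that)
    have "real K \<ge> 4 * \<tau> + 4" using bnd(3)[of K] by simp
    then show "K \<ge> 1" "N \<le> K" using tau1 N by linarith+
    fix k assume k: "k \<ge> K"
    show "t k \<ge> T" using bnd(1)[OF k] tk[of k] by linarith
    have tS: "t (Suc k) = t k + 1" by (simp add: t)
    have t1: "t k \<ge> 1" using bnd(3)[OF k] tk[of k] tau1 by linarith
    have "6 / \<kappa> \<le> t k" using bnd(2)[OF k] tk[of k] by linarith
    then have "6 \<le> \<kappa> * t k" using kap by (simp add: field_simps)
    then have "6 * t k \<le> \<kappa> * t k * t k" using t1 by (intro mult_right_mono) auto
    then have a: "3 * t k \<le> \<kappa> / 2 * (t k)\<^sup>2" by (simp add: power2_eq_square)
    have "(1 - \<kappa>) * (2 * t k + 1) \<le> 1 * (3 * t k)" using kap t1 by (intro mult_mono) auto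
    then show "(1 - \<kappa>) * (t (Suc k))\<^sup>2 \<le> (1 - \<kappa> / 2) * (t k)\<^sup>2"
      using a unfolding tS by (simp add: power2_eq_square algebra_simps)
    fix j assume j: "j < N"
    have "t (k - j) = t k - real j" using j \<open>N \<le> K\<close> k by (simp add: t of_nat_diff)
    then have "t (k - j) \<ge> t k - \<tau>" using j N by simp
    moreover have "4 * \<tau> + 4 \<le> t k" using bnd(3)[OF k] tk[of k] by linarith
    ultimately have "3 * (t k + 1) \<le> 4 * t (k - j)" by (simp add: algebra_simps)
    then have "(3 * (t k + 1))\<^sup>2 \<le> (4 * t (k - j))\<^sup>2" using t1 by (intro power_mono) auto
    then show "(t (Suc k))\<^sup>2 \<le> 2 * (t (k - j))\<^sup>2"
    proof -
      have "9 * (t k + 1)\<^sup>2 \<le> 16 * (t (k - j))\<^sup>2"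
        using \<open>(3 * (t k + 1))\<^sup>2 \<le> (4 * t (k - j))\<^sup>2\<close> unfolding power_mult_distrib by simp
      then show ?thesis unfolding tS using zero_le_power2[of "t (k - j)"] by linarith
    qed
  qed
qed

end

subsection \<open>Paths of the scheme\<close>

text \<open>A single trajectory with arbitrary initial vectors; no probability enters here.\<close>

locale afp_path = afp_params +
  fixes G :: "'a::euclidean_space \<Rightarrow> 'a" and x y z Gt :: "nat \<Rightarrow> 'a" and t :: "nat \<Rightarrow> real"
  assumes t: "\<And>k. t k = real k + 3 * s + \<tau>"
    and coco: "\<And>p q. \<beta> * (norm (G p - G q))\<^sup>2 \<le> inner (G p - G q) (p - q)"
    and x_Suc: "\<And>k. x (Suc k) = y k - (\<eta> * t k / (2 * (t k - s))) *\<^sub>R Gt k"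
    and z_Suc: "\<And>k. z (Suc k) = z k + (\<gamma> / s) *\<^sub>R (x (Suc k) - y k)"
    and y_Suc: "\<And>k. y (Suc k) = ((t k - s) / t k) *\<^sub>R x (Suc k) + (s / t k) *\<^sub>R z (Suc k)"
begin

definition "g k = G (y k)"
definition "e k = Gt k - g k"
definition "v k = y k - z k"
definition "A k = s * (t k - 1) * inner (g k) (v k) + \<eta> / 4 * (t k - 1)\<^sup>2 * (norm (g k))\<^sup>2"
definition "Z xo k = A k + (w + M0 / t k) * (norm (z k - xo))\<^sup>2"

lemma t_Suc: "t (Suc k) = t k + 1" by (simp add: t)

lemma t_gt: "t k > 3" "t k > s" "t k > 0" "t k \<ge> 2 * s"
  using s1 tau1 by (auto simp: t)

lemma x_Suc': "x (Suc k) = y k - (\<eta> * t k / (2 * (t k - s))) *\<^sub>R (g k + e k)"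
  by (simp add: x_Suc e_def)

lemma Sinc_nonneg: "0 \<le> Sinc (G p - G q) (p - q)"
  unfolding Sinc_def using coco[of p q] Thnn rhonn by simp

lemma Z_Suc_le:
  assumes "t k \<ge> T" "G xo = 0"
  shows "Z xo (Suc k) + c / 4 * t k * (norm (g k))\<^sup>2 + b * (t k)\<^sup>2 * Sinc (g (Suc k) - g k) (y (Suc k) - y k)
    \<le> Z xo k + 4 * \<epsilon> * (t k)\<^sup>2 * (norm (e k))\<^sup>2"
proof -
  have "inner (g k) (y k - xo) \<ge> \<beta> * (norm (g k))\<^sup>2"
    using coco[of "y k" xo] assms(2) by (simp add: g_def)
  then have mon: "inner (g k) (y k - xo) \<ge> 0"
    using betapos by (meson mult_nonneg_nonneg less_imp_le order_trans zero_le_power2)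
  show ?thesis
    using Z_step[OF assms(1) refl x_Suc' z_Suc y_Suc coco[of "y (Suc k)" "y k", folded g_def] mon]
    by (simp add: Z_def A_def t_Suc v_def)
qed

text \<open>\<open>A\<close> refers to no zero of \<open>G\<close>. Without monotonicity at a zero,
  the product of \<open>norm (g k)\<close> and \<open>norm (v k)\<close> stays on the right;
  \<open>sum_gv\<close> makes it summable.\<close>

lemma A_Suc_le:
  assumes "t k \<ge> T"
  shows "A (Suc k) \<le> A k + (s * (s - 1) * (norm (g k) * norm (v k)) + (2 * \<epsilon> * (t k)\<^sup>2 + C1 * t k) * (norm (e k))\<^sup>2)"
proof -
  have 1: "b * (t k)\<^sup>2 * Sinc (g (Suc k) - g k) (y (Suc k) - y k) \<ge> 0"
    unfolding g_def using Sinc_nonneg bpos by (intro mult_nonneg_nonneg) auto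
  have 2: "3 / 4 * c * t k * (norm (g k))\<^sup>2 \<ge> 0"
    using cpos t_gt(3)[of k] by simp
  have "s * (s - 1) * (- inner (g k) (v k)) \<le> s * (s - 1) * (norm (g k) * norm (v k))"
    using norm_cauchy_schwarz[of "- g k" "v k"] s1 by (intro mult_left_mono) auto
  then have 3: "- (s * (s - 1) * inner (g k) (v k)) \<le> s * (s - 1) * (norm (g k) * norm (v k))"
    by simp
  have 4: "t (Suc k) - 1 = t k" by (simp add: t_Suc)
  have lin: "l \<le> p + (q' + r)" if "l \<le> p - q - a1 - a2 + r" "0 \<le> a1" "0 \<le> a2" "- q \<le> q'"
    for l p q q' a1 a2 r :: real
    using that by linarith
  show ?thesis
    unfolding A_def 4
    by (rule lin[OF A_step_le[OF T_ge(1)[OF assms] refl x_Suc' z_Suc y_Suc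
          coco[of "y (Suc k)" "y k", folded g_def], folded v_def] 2 1 3])
qed

text \<open>Half of the quadratic term of \<open>A\<close> survives Young's inequality. Hence
  \<open>A\<close> is bounded below when \<open>v\<close> is bounded, and it controls
  \<open>t^2 |g|^2\<close> when \<open>v\<close> tends to 0.\<close>

lemma A_lower: "A k \<ge> \<eta> / 8 * (t k - 1)\<^sup>2 * (norm (g k))\<^sup>2 - 2 * s\<^sup>2 / \<eta> * (norm (v k))\<^sup>2"
proof -
  have "(s * (t k - 1)) * (- inner (g k) (v k)) \<le> (s * (t k - 1)) * (norm (g k) * norm (v k))"
    using norm_cauchy_schwarz[of "- g k" "v k"] s1 t_gt(1)[of k] by (intro mult_left_mono) auto
  also have "\<dots> = (s * (t k - 1)) * norm (g k) * norm (v k)" by simp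
  also have "\<dots> \<le> \<eta> / 8 * (t k - 1)\<^sup>2 * (norm (g k))\<^sup>2 + 2 * s\<^sup>2 / \<eta> * (norm (v k))\<^sup>2"
    using etapos t_gt(1)[of k] by (intro Young_ineq) (auto simp: power_mult_distrib)
  finally show ?thesis unfolding A_def by simp
qed

lemma abs_A_le: "\<bar>A k\<bar> \<le> t k * (s * (norm (g k) * norm (v k)) + \<eta> / 4 * (t k * (norm (g k))\<^sup>2))"
proof -
  have t1: "t k - 1 \<ge> 0" "t k - 1 \<le> t k" using t_gt(1)[of k] by auto
  have "\<bar>A k\<bar> \<le> \<bar>s * (t k - 1) * inner (g k) (v k)\<bar> + \<bar>\<eta> / 4 * (t k - 1)\<^sup>2 * (norm (g k))\<^sup>2\<bar>"
    unfolding A_def by (rule abs_triangle_ineq)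
  also have "\<dots> = s * ((t k - 1) * \<bar>inner (g k) (v k)\<bar>) + \<eta> / 4 * ((t k - 1)\<^sup>2 * (norm (g k))\<^sup>2)"
    using s1 t1 etapos by (simp add: abs_mult)
  also have "\<dots> \<le> s * (t k * (norm (g k) * norm (v k))) + \<eta> / 4 * ((t k)\<^sup>2 * (norm (g k))\<^sup>2)"
    using s1 t1 etapos
    by (intro add_mono mult_left_mono mult_mono power_mono Cauchy_Schwarz_ineq2) auto
  finally show ?thesis by (simp add: power2_eq_square algebra_simps)
qed

text \<open>Monotonicity at \<open>xo\<close> bounds the indefinite product by
  \<open>norm (g k) * norm (z k - xo)\<close>. Young's inequality then costs
  \<open>(s^2 / \<eta>) |z k - xo|^2\<close>, which \<open>w\<close> covers because
  \<open>s - 1 \<ge> \<gamma>\<close>.\<close>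

lemma Z_nonneg:
  assumes "G xo = 0"
  shows "Z xo k \<ge> 0"
proof -
  define u where "u = z k - xo"
  have "inner (g k) (y k - xo) \<ge> \<beta> * (norm (g k))\<^sup>2"
    using coco[of "y k" xo] assms by (simp add: g_def)
  then have mon: "inner (g k) (y k - xo) \<ge> 0"
    using betapos by (meson mult_nonneg_nonneg less_imp_le order_trans zero_le_power2)
  have "inner (g k) (v k) = inner (g k) (y k - xo) - inner (g k) u"
    by (simp add: v_def u_def inner_diff_right)
  then have "- inner (g k) (v k) \<le> norm (g k) * norm u"
    using mon norm_cauchy_schwarz[of "g k" u] by linarith
  then have "(s * (t k - 1)) * (- inner (g k) (v k)) \<le> (s * (t k - 1)) * (norm (g k) * norm u)"
    using s1 t_gt(1)[of k] by (intro mult_left_mono) auto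
  also have "\<dots> = (s * (t k - 1)) * norm (g k) * norm u" by simp
  also have "\<dots> \<le> \<eta> / 4 * (t k - 1)\<^sup>2 * (norm (g k))\<^sup>2 + s\<^sup>2 / \<eta> * (norm u)\<^sup>2"
    using etapos t_gt(1)[of k] by (intro Young_ineq) (auto simp: power_mult_distrib)
  finally have 1: "A k \<ge> - (s\<^sup>2 / \<eta> * (norm u)\<^sup>2)" unfolding A_def by simp
  have "s\<^sup>2 / \<eta> \<le> w"
  proof -
    have "s\<^sup>2 / \<eta> * 1 \<le> s\<^sup>2 / \<eta> * ((s - 1) / \<gamma>)"
      using etapos gpos sg by (intro mult_left_mono) (auto simp: field_simps)
    then show ?thesis by (simp add: w_def mult_ac)
  qed
  also have "w \<le> w + M0 / t k" using Mpos t_gt(3)[of k] by simp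
  finally have "s\<^sup>2 / \<eta> * (norm u)\<^sup>2 \<le> (w + M0 / t k) * (norm u)\<^sup>2"
    by (intro mult_right_mono) auto
  then show ?thesis using 1 by (simp add: Z_def u_def)
qed

lemma step_size: "0 \<le> \<eta> * t k / (2 * (t k - s))" "\<eta> * t k / (2 * (t k - s)) \<le> \<eta>"
  using etapos t_gt[of k] by (auto simp: field_simps)

text \<open>One step reads \<open>v (Suc k) = (1 - s / t k) (v k - l (g k + e k))\<close> with a
  bounded factor \<open>l\<close>, and the contraction produces the loss
  \<open>s |v k|^2 / t k\<close>.\<close>

lemma v_Suc_le:
  "(norm (v (Suc k)))\<^sup>2 \<le> (norm (v k))\<^sup>2 - s * ((norm (v k))\<^sup>2 / t k)
     + 2 * \<eta>\<^sup>2 / s * (t k * (norm (g k))\<^sup>2 + t k * (norm (e k))\<^sup>2)"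
proof -
  define a where "a = s / t k"
  have a: "0 < a" "a < 1" unfolding a_def using s1 t_gt[of k] by auto
  define ek where "ek = \<eta> * t k / (2 * (t k - s))"
  define l where "l = ek * (1 - \<gamma> / s)"
  define n where "n = norm (v k)"
  define m where "m = \<eta> * norm (g k + e k)"
  have gs: "0 \<le> 1 - \<gamma> / s" "1 - \<gamma> / s \<le> 1" using gpos s1 g1 by auto
  have l: "0 \<le> l" "l \<le> \<eta>"
    unfolding l_def using step_size[of k, folded ek_def] gs
    by (auto intro: order_trans[OF mult_right_le_one_le])
  have a': "(t k - s) / t k = 1 - a" unfolding a_def using t_gt(3)[of k] by (simp add: field_simps)
  have "v (Suc k) = (1 - a) *\<^sub>R (x (Suc k) - z (Suc k))"
    unfolding v_def y_Suc a' a_def[symmetric] by (simp add: algebra_simps)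
  also have "x (Suc k) - z (Suc k) = v k - l *\<^sub>R (g k + e k)"
    unfolding z_Suc x_Suc' ek_def[symmetric] v_def l_def by (simp add: algebra_simps)
  finally have "norm (v (Suc k)) = (1 - a) * norm (v k - l *\<^sub>R (g k + e k))" using a by simp
  also have "\<dots> \<le> (1 - a) * (n + m)"
  proof (intro mult_left_mono)
    have "norm (v k - l *\<^sub>R (g k + e k)) \<le> n + l * norm (g k + e k)"
      using norm_triangle_ineq4[of "v k" "l *\<^sub>R (g k + e k)"] l by (simp add: n_def)
    also have "\<dots> \<le> n + m" using l by (simp add: m_def mult_right_mono)
    finally show "norm (v k - l *\<^sub>R (g k + e k)) \<le> n + m" .
  qed (use a in simp)
  finally have "(norm (v (Suc k)))\<^sup>2 \<le> ((1 - a) * (n + m))\<^sup>2" by (intro power_mono) auto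
  also have "\<dots> = (1 - a)\<^sup>2 * n\<^sup>2 + (2 * (1 - a)\<^sup>2) * n * m + (1 - a)\<^sup>2 * m\<^sup>2"
    by (simp add: power2_eq_square algebra_simps)
  \<comment> \<open>The Young weight \<open>a (1 - a)\<close> is what raises
    \<open>(1 - a)^2\<close> to exactly \<open>1 - a\<close>, so one of the two available losses of
    size \<open>a\<close> is kept.\<close>
  also have "(2 * (1 - a)\<^sup>2) * n * m \<le> (a * (1 - a)) * n\<^sup>2 + ((1 - a) ^ 3 / a) * m\<^sup>2"
    using a by (intro Young_ineq) (auto simp: power2_eq_square power3_eq_cube)
  finally have "(norm (v (Suc k)))\<^sup>2 \<le> ((1 - a)\<^sup>2 + a * (1 - a)) * n\<^sup>2 + ((1 - a)\<^sup>2 + (1 - a) ^ 3 / a) * m\<^sup>2"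
    by (simp add: algebra_simps)
  also have "(1 - a)\<^sup>2 + a * (1 - a) = 1 - a" by (simp add: power2_eq_square algebra_simps)
  also have "(1 - a)\<^sup>2 + (1 - a) ^ 3 / a = (1 - a)\<^sup>2 / a"
    using a by (simp add: field_simps power2_eq_square power3_eq_cube)
  also have "(1 - a)\<^sup>2 / a * m\<^sup>2 \<le> 1 / a * m\<^sup>2"
    using a by (intro mult_right_mono divide_right_mono) (auto intro: power_le_one)
  also have "1 / a * m\<^sup>2 = \<eta>\<^sup>2 / s * t k * (norm (g k + e k))\<^sup>2"
    by (simp add: a_def m_def power_mult_distrib)
  also have "\<dots> \<le> \<eta>\<^sup>2 / s * t k * (2 * ((norm (g k))\<^sup>2 + (norm (e k))\<^sup>2))"
    using s1 t_gt(3)[of k] norm_add_square_le by (intro mult_left_mono) auto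
  finally show ?thesis by (simp add: a_def n_def algebra_simps)
qed

lemma x_y: "x (Suc k) - y (Suc k) = (s / (t k - s)) *\<^sub>R v (Suc k)"
proof -
  have "(t k - s) *\<^sub>R (x (Suc k) - y (Suc k)) = s *\<^sub>R v (Suc k)"
  proof -
    have "t k *\<^sub>R y (Suc k) = (t k - s) *\<^sub>R x (Suc k) + s *\<^sub>R z (Suc k)"
      unfolding y_Suc using t_gt(3)[of k] by (simp add: scaleR_add_right)
    then show ?thesis unfolding v_def by (simp add: algebra_simps)
  qed
  then have "(1 / (t k - s)) *\<^sub>R ((t k - s) *\<^sub>R (x (Suc k) - y (Suc k))) = (1 / (t k - s)) *\<^sub>R (s *\<^sub>R v (Suc k))"
    by simp
  then show ?thesis using t_gt(2)[of k] by simp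
qed

text \<open>The difference is one scheme step minus the gap between \<open>x\<close> and
  \<open>y\<close>, and by \<open>x_y\<close> this gap is of order \<open>|v| / t\<close>. The index
  starts at 1 since \<open>x 0\<close> is not tied to \<open>y 0\<close>.\<close>

lemma x_diff_le:
  "(norm (x (Suc (Suc k)) - x (Suc k)))\<^sup>2 \<le>
    3 * (\<eta>\<^sup>2 * (norm (g (Suc k)))\<^sup>2 + \<eta>\<^sup>2 * (norm (e (Suc k)))\<^sup>2 + 4 * s\<^sup>2 * (norm (v (Suc k)))\<^sup>2 / (t (Suc k))\<^sup>2)"
proof -
  define ek where "ek = \<eta> * t (Suc k) / (2 * (t (Suc k) - s))"
  define p q r where "p = \<eta> * norm (g (Suc k))" and "q = \<eta> * norm (e (Suc k))"
    and "r = 2 * s * norm (v (Suc k)) / t (Suc k)"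
  have ek: "0 \<le> ek" "ek \<le> \<eta>" using step_size[of "Suc k"] by (auto simp: ek_def)
  have "x (Suc (Suc k)) - x (Suc k) = - (ek *\<^sub>R (g (Suc k) + e (Suc k))) - (x (Suc k) - y (Suc k))"
    unfolding x_Suc'[of "Suc k"] ek_def by simp
  also have "norm \<dots> \<le> norm (ek *\<^sub>R (g (Suc k) + e (Suc k))) + norm (x (Suc k) - y (Suc k))"
    by (metis norm_minus_cancel norm_triangle_ineq4)
  also have "\<dots> \<le> (p + q) + r"
  proof (rule add_mono)
    have "norm (ek *\<^sub>R (g (Suc k) + e (Suc k))) \<le> \<eta> * (norm (g (Suc k)) + norm (e (Suc k)))"
      using ek norm_triangle_ineq[of "g (Suc k)" "e (Suc k)"] by (auto intro: mult_mono)
    then show "norm (ek *\<^sub>R (g (Suc k) + e (Suc k))) \<le> p + q" by (simp add: p_def q_def algebra_simps)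
    have "t (Suc k) / 2 \<le> t k - s" using s1 tau1 by (simp add: t)
    then have "s / (t k - s) \<le> s / (t (Suc k) / 2)"
      using s1 t_gt(3)[of "Suc k"] t_gt(2)[of k] by (intro divide_left_mono) auto
    then have "s / (t k - s) * norm (v (Suc k)) \<le> s / (t (Suc k) / 2) * norm (v (Suc k))"
      by (rule mult_right_mono) simp
    then show "norm (x (Suc k) - y (Suc k)) \<le> r"
      unfolding x_y r_def using s1 t_gt(2)[of k] by (simp add: mult_ac)
  qed
  finally have "(norm (x (Suc (Suc k)) - x (Suc k)))\<^sup>2 \<le> (p + q + r)\<^sup>2" by (intro power_mono) auto
  also have "\<dots> \<le> 3 * (p\<^sup>2 + q\<^sup>2 + r\<^sup>2)"
    using sum_squares_bound[of p q] sum_squares_bound[of p r] sum_squares_bound[of q r]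
    by (simp add: power2_eq_square algebra_simps)
  finally show ?thesis by (simp add: p_def q_def r_def power_mult_distrib power_divide)
qed

lemma eventually_T: "\<exists>K. \<forall>k\<ge>K. t k \<ge> T"
proof (intro exI allI impI)
  fix k assume "k \<ge> nat \<lceil>T\<rceil>"
  then have "T \<le> real k" by linarith
  then show "t k \<ge> T" using s1 tau1 by (simp add: t)
qed

section \<open>Rates and convergence along a path with summable residuals and errors\<close>

context
  assumes sum_g: "summable (\<lambda>k. t k * (norm (g k))\<^sup>2)"
    and sum_e: "summable (\<lambda>k. (t k)\<^sup>2 * (norm (e k))\<^sup>2)"
begin

lemma sum_te: "summable (\<lambda>k. t k * (norm (e k))\<^sup>2)"
proof (rule summable_comparison_test[OF _ sum_e], intro exI allI impI)
  fix k
  have "t k * (norm (e k))\<^sup>2 \<le> (t k)\<^sup>2 * (norm (e k))\<^sup>2"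
    using t_gt(1)[of k] by (intro mult_right_mono) (auto simp: power2_eq_square)
  then show "norm (t k * (norm (e k))\<^sup>2) \<le> (t k)\<^sup>2 * (norm (e k))\<^sup>2"
    using t_gt(3)[of k] by simp
qed

text \<open>The perturbation in \<open>v_Suc_le\<close> is summable, so \<open>|v|^2\<close>
  converges and the losses \<open>s |v|^2 / t\<close> telescope to a finite sum; comparison with the
  harmonic series then leaves 0 as the only limit.\<close>

lemma v_facts: "summable (\<lambda>k. (norm (v k))\<^sup>2 / t k)" "(\<lambda>k. (norm (v k))\<^sup>2) \<longlonglongrightarrow> 0"
proof -
  define f where "f k = 2 * \<eta>\<^sup>2 / s * (t k * (norm (g k))\<^sup>2 + t k * (norm (e k))\<^sup>2)" for k
  have sf: "summable f" unfolding f_def by (intro summable_mult summable_add sum_g sum_te)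
  have st: "(norm (v (Suc k)))\<^sup>2 \<le> (norm (v k))\<^sup>2 - s * ((norm (v k))\<^sup>2 / t k) + f k" for k
    using v_Suc_le[of k] by (simp add: f_def)
  have nn: "s * ((norm (v k))\<^sup>2 / t k) \<ge> 0" for k using s1 t_gt(3)[of k] by simp
  have conv: "convergent (\<lambda>k. (norm (v k))\<^sup>2)"
  proof (rule convergent_quasi_decreasing[OF _ sf, of 0 _ 0])
    show "(norm (v (Suc k)))\<^sup>2 \<le> (norm (v k))\<^sup>2 + f k" for k using st[of k] nn[of k] by linarith
  qed simp
  then obtain L where "(\<lambda>k. (norm (v k))\<^sup>2) \<longlonglongrightarrow> L" by (auto simp: convergent_def)
  then have "summable (\<lambda>k. (norm (v k))\<^sup>2 - (norm (v (Suc k)))\<^sup>2)" by (rule telescope_summable')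
  then have sd: "summable (\<lambda>k. (norm (v k))\<^sup>2 - (norm (v (Suc k)))\<^sup>2 + f k)" by (rule summable_add[OF _ sf])
  have "summable (\<lambda>k. s * ((norm (v k))\<^sup>2 / t k))"
  proof (rule summable_comparison_test[OF _ sd], intro exI allI impI)
    show "norm (s * ((norm (v k))\<^sup>2 / t k)) \<le> (norm (v k))\<^sup>2 - (norm (v (Suc k)))\<^sup>2 + f k" for k
      using st[of k] nn[of k] by simp
  qed
  then show sv: "summable (\<lambda>k. (norm (v k))\<^sup>2 / t k)" by (rule summable_mult_D) (use s1 in simp)
  show "(\<lambda>k. (norm (v k))\<^sup>2) \<longlonglongrightarrow> 0"
    by (rule tendsto_zero_if_harmonic_summable[OF conv _ sv, of "3 * s + \<tau>"])
      (use s1 tau1 in \<open>auto simp: t\<close>)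
qed

text \<open>Young's inequality with weight \<open>t k\<close> compares the product with two series
  already known to converge.\<close>

lemma sum_gv: "summable (\<lambda>k. norm (g k) * norm (v k))"
proof (rule summable_comparison_test[OF _ summable_add[OF sum_g v_facts(1)]], intro exI allI impI)
  fix k
  have "1 * norm (g k) * norm (v k) \<le> t k / 2 * (norm (g k))\<^sup>2 + 1 / (2 * t k) * (norm (v k))\<^sup>2"
    using t_gt(3)[of k] by (intro Young_ineq) auto
  also have "\<dots> \<le> t k * (norm (g k))\<^sup>2 + (norm (v k))\<^sup>2 / t k"
    using t_gt(3)[of k] by (intro add_mono) (auto simp: field_simps)
  finally show "norm (norm (g k) * norm (v k)) \<le> t k * (norm (g k))\<^sup>2 + (norm (v k))\<^sup>2 / t k" by simp
qed

text \<open>\<open>A_Suc_le\<close> and \<open>A_lower\<close> give convergence. By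
  \<open>abs_A_le\<close> the quotients \<open>|A k| / t k\<close> are summable, which excludes a
  nonzero limit.\<close>

lemma A_tendsto: "A \<longlonglongrightarrow> 0"
proof -
  obtain K where K: "\<And>k. k \<ge> K \<Longrightarrow> t k \<ge> T" using eventually_T by blast
  define f where "f k = s * (s - 1) * (norm (g k) * norm (v k)) + (2 * \<epsilon> * (t k)\<^sup>2 + C1 * t k) * (norm (e k))\<^sup>2" for k
  have f': "f = (\<lambda>k. s * (s - 1) * (norm (g k) * norm (v k)) + (2 * \<epsilon> * ((t k)\<^sup>2 * (norm (e k))\<^sup>2) + C1 * (t k * (norm (e k))\<^sup>2)))"
    unfolding f_def by (simp add: algebra_simps)
  have sf: "summable f" unfolding f' by (intro summable_mult summable_add sum_gv sum_e sum_te)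
  obtain X where X: "\<And>k. norm ((norm (v k))\<^sup>2) \<le> X"
    using convergent_imp_Bseq[OF convergentI[OF v_facts(2)]] unfolding Bseq_def by blast
  have conv: "convergent A"
  proof (rule convergent_quasi_decreasing[OF _ sf])
    show "A (Suc k) \<le> A k + f k" if "k \<ge> K" for k using A_Suc_le[OF K[OF that]] by (simp add: f_def)
    show "- (2 * s\<^sup>2 / \<eta> * X) \<le> A k" if "k \<ge> K" for k
    proof -
      have "2 * s\<^sup>2 / \<eta> * (norm (v k))\<^sup>2 \<le> 2 * s\<^sup>2 / \<eta> * X"
        using X[of k] etapos by (intro mult_left_mono) auto
      moreover have "\<eta> / 8 * (t k - 1)\<^sup>2 * (norm (g k))\<^sup>2 \<ge> 0" using etapos by simp
      ultimately show ?thesis using A_lower[of k] by linarith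
    qed
  qed
  have "(\<lambda>k. \<bar>A k\<bar>) \<longlonglongrightarrow> 0"
  proof (rule tendsto_zero_if_harmonic_summable)
    show "convergent (\<lambda>k. \<bar>A k\<bar>)" using conv unfolding convergent_def by (blast intro: tendsto_rabs)
    have "summable (\<lambda>k. s * (norm (g k) * norm (v k)) + \<eta> / 4 * (t k * (norm (g k))\<^sup>2))"
      by (intro summable_mult summable_add sum_gv sum_g)
    then show "summable (\<lambda>k. \<bar>A k\<bar> / t k)"
    proof (rule summable_comparison_test[rotated], intro exI allI impI)
      show "norm (\<bar>A k\<bar> / t k) \<le> s * (norm (g k) * norm (v k)) + \<eta> / 4 * (t k * (norm (g k))\<^sup>2)" for k
        using abs_A_le[of k] t_gt(3)[of k] by (simp add: pos_divide_le_eq mult.commute)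
    qed
    show "t k = real k + (3 * s + \<tau>)" for k by (simp add: t)
  qed (use s1 tau1 in auto)
  then show ?thesis by (rule tendsto_rabs_zero_cancel)
qed

lemma g_tendsto: "(\<lambda>k. (t k - 1)\<^sup>2 * (norm (g k))\<^sup>2) \<longlonglongrightarrow> 0"
proof (rule tendsto_sandwich[of "\<lambda>_. 0" _ _ "\<lambda>k. 8 / \<eta> * (A k + 2 * s\<^sup>2 / \<eta> * (norm (v k))\<^sup>2)"])
  have "(t k - 1)\<^sup>2 * (norm (g k))\<^sup>2 \<le> 8 / \<eta> * (A k + 2 * s\<^sup>2 / \<eta> * (norm (v k))\<^sup>2)" for k
  proof -
    have "8 / \<eta> * (\<eta> / 8 * (t k - 1)\<^sup>2 * (norm (g k))\<^sup>2) \<le> 8 / \<eta> * (A k + 2 * s\<^sup>2 / \<eta> * (norm (v k))\<^sup>2)"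
      using A_lower[of k] etapos by (intro mult_left_mono) auto
    then show ?thesis using etapos by simp
  qed
  then show "\<forall>\<^sub>F k in sequentially. (t k - 1)\<^sup>2 * (norm (g k))\<^sup>2 \<le> 8 / \<eta> * (A k + 2 * s\<^sup>2 / \<eta> * (norm (v k))\<^sup>2)"
    by simp
  have "(\<lambda>k. 8 / \<eta> * (A k + 2 * s\<^sup>2 / \<eta> * (norm (v k))\<^sup>2)) \<longlonglongrightarrow> 8 / \<eta> * (0 + 2 * s\<^sup>2 / \<eta> * 0)"
    by (intro tendsto_intros A_tendsto v_facts)
  then show "(\<lambda>k. 8 / \<eta> * (A k + 2 * s\<^sup>2 / \<eta> * (norm (v k))\<^sup>2)) \<longlonglongrightarrow> 0" by simp
qed auto

lemma sum_G: "summable (\<lambda>k. (real k + \<tau>) * (norm (G (y k)))\<^sup>2)"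
proof (rule summable_comparison_test[OF _ sum_g], intro exI allI impI)
  show "norm ((real k + \<tau>) * (norm (G (y k)))\<^sup>2) \<le> t k * (norm (g k))\<^sup>2" for k
    using s1 tau1 by (auto simp: g_def t intro!: mult_right_mono)
qed

lemma lim_G: "(\<lambda>k. (real k + \<tau>)\<^sup>2 * (norm (G (y k)))\<^sup>2) \<longlonglongrightarrow> 0"
proof (rule tendsto_sandwich[OF _ _ tendsto_const g_tendsto])
  have "(real k + \<tau>)\<^sup>2 \<le> (t k - 1)\<^sup>2" for k using s1 tau1 by (intro power_mono) (auto simp: t)
  then show "\<forall>\<^sub>F k in sequentially. (real k + \<tau>)\<^sup>2 * (norm (G (y k)))\<^sup>2 \<le> (t k - 1)\<^sup>2 * (norm (g k))\<^sup>2"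
    by (simp add: g_def mult_right_mono)
qed auto

lemma sum_x: "summable (\<lambda>k. (real k + \<tau>) * (norm (x (Suc k) - x k))\<^sup>2)"
proof (rule summable_Suc_iff[THEN iffD1])
  have "summable (\<lambda>k. 3 * (\<eta>\<^sup>2 * (t k * (norm (g k))\<^sup>2) + \<eta>\<^sup>2 * (t k * (norm (e k))\<^sup>2) + 4 * s\<^sup>2 * ((norm (v k))\<^sup>2 / t k)))"
    (is "summable ?f")
    by (intro summable_mult summable_add sum_g sum_te v_facts)
  then have sf: "summable (\<lambda>k. ?f (Suc k))" by (rule summable_Suc_iff[THEN iffD2])
  show "summable (\<lambda>k. (real (Suc k) + \<tau>) * (norm (x (Suc (Suc k)) - x (Suc k)))\<^sup>2)"
  proof (rule summable_comparison_test[OF _ sf], intro exI allI impI)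
    fix k
    have "(real (Suc k) + \<tau>) * (norm (x (Suc (Suc k)) - x (Suc k)))\<^sup>2 \<le> t (Suc k) *
      (3 * (\<eta>\<^sup>2 * (norm (g (Suc k)))\<^sup>2 + \<eta>\<^sup>2 * (norm (e (Suc k)))\<^sup>2 + 4 * s\<^sup>2 * (norm (v (Suc k)))\<^sup>2 / (t (Suc k))\<^sup>2))"
      using s1 tau1 by (intro mult_mono x_diff_le) (auto simp: t)
    also have "\<dots> = ?f (Suc k)"
      using t_gt(3)[of "Suc k"] by (simp add: power2_eq_square field_simps)
    finally show "norm ((real (Suc k) + \<tau>) * (norm (x (Suc (Suc k)) - x (Suc k)))\<^sup>2) \<le> ?f (Suc k)"
      using tau1 by simp
  qed
qed

lemma lim_x: "(\<lambda>k. (real k + \<tau>)\<^sup>2 * (norm (x (Suc k) - x k))\<^sup>2) \<longlonglongrightarrow> 0"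
proof (rule filterlim_sequentially_Suc[THEN iffD1])
  \<comment> \<open>The factor 4 comes from \<open>t \<le> 2 (t - 1)\<close>. The weight
    \<open>t^2\<close> cancels against the decay of the \<open>v\<close> term, so \<open>v\<close>
    tending to 0 is enough.\<close>
  define f where "f k = 3 * (4 * \<eta>\<^sup>2 * ((t k - 1)\<^sup>2 * (norm (g k))\<^sup>2) + \<eta>\<^sup>2 * ((t k)\<^sup>2 * (norm (e k))\<^sup>2) + 4 * s\<^sup>2 * (norm (v k))\<^sup>2)" for k
  have "f \<longlonglongrightarrow> 3 * (4 * \<eta>\<^sup>2 * 0 + \<eta>\<^sup>2 * 0 + 4 * s\<^sup>2 * 0)"
    unfolding f_def by (intro tendsto_intros g_tendsto v_facts summable_LIMSEQ_zero[OF sum_e])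
  then have "f \<longlonglongrightarrow> 0" by simp
  then have lim: "(\<lambda>k. f (Suc k)) \<longlonglongrightarrow> 0" by (rule LIMSEQ_Suc)
  show "(\<lambda>k. (real (Suc k) + \<tau>)\<^sup>2 * (norm (x (Suc (Suc k)) - x (Suc k)))\<^sup>2) \<longlonglongrightarrow> 0"
  proof (rule tendsto_sandwich[OF _ _ tendsto_const lim])
    have "(real (Suc k) + \<tau>)\<^sup>2 * (norm (x (Suc (Suc k)) - x (Suc k)))\<^sup>2 \<le> f (Suc k)" for k
    proof -
      have "(real (Suc k) + \<tau>)\<^sup>2 * (norm (x (Suc (Suc k)) - x (Suc k)))\<^sup>2 \<le> (t (Suc k))\<^sup>2 *
        (3 * (\<eta>\<^sup>2 * (norm (g (Suc k)))\<^sup>2 + \<eta>\<^sup>2 * (norm (e (Suc k)))\<^sup>2 + 4 * s\<^sup>2 * (norm (v (Suc k)))\<^sup>2 / (t (Suc k))\<^sup>2))"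
        using s1 tau1 by (intro mult_mono x_diff_le power_mono) (auto simp: t)
      also have "\<dots> = 3 * (\<eta>\<^sup>2 * ((t (Suc k))\<^sup>2 * (norm (g (Suc k)))\<^sup>2) + \<eta>\<^sup>2 * ((t (Suc k))\<^sup>2 * (norm (e (Suc k)))\<^sup>2) + 4 * s\<^sup>2 * (norm (v (Suc k)))\<^sup>2)"
        using t_gt(3)[of "Suc k"] by (simp add: algebra_simps)
      also have "\<dots> \<le> f (Suc k)"
      proof -
        have "(t (Suc k))\<^sup>2 \<le> (2 * (t (Suc k) - 1))\<^sup>2" using t_gt(1)[of "Suc k"] by (intro power_mono) auto
        then have "(t (Suc k))\<^sup>2 * (norm (g (Suc k)))\<^sup>2 \<le> (2 * (t (Suc k) - 1))\<^sup>2 * (norm (g (Suc k)))\<^sup>2"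
          by (rule mult_right_mono) simp
        then have "\<eta>\<^sup>2 * ((t (Suc k))\<^sup>2 * (norm (g (Suc k)))\<^sup>2) \<le> \<eta>\<^sup>2 * ((2 * (t (Suc k) - 1))\<^sup>2 * (norm (g (Suc k)))\<^sup>2)"
          by (rule mult_left_mono) simp
        then show ?thesis unfolding f_def power_mult_distrib by simp
      qed
      finally show ?thesis .
    qed
    then show "\<forall>\<^sub>F k in sequentially. (real (Suc k) + \<tau>)\<^sup>2 * (norm (x (Suc (Suc k)) - x (Suc k)))\<^sup>2 \<le> f (Suc k)"
      by simp
  qed auto
qed

text \<open>\<open>Z xo\<close> is quasi-decreasing and nonnegative, hence convergent. Since
  \<open>A\<close> tends to 0 and the distance weight tends to \<open>w > 0\<close>, the distance
  converges as well.\<close>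

lemma dist_convergent:
  assumes "G xo = 0"
  shows "convergent (\<lambda>k. norm (z k - xo))"
proof -
  obtain K where K: "\<And>k. k \<ge> K \<Longrightarrow> t k \<ge> T" using eventually_T by blast
  have "convergent (Z xo)"
  proof (rule convergent_quasi_decreasing)
    show "summable (\<lambda>k. 4 * \<epsilon> * ((t k)\<^sup>2 * (norm (e k))\<^sup>2))" by (intro summable_mult sum_e)
    show "Z xo (Suc k) \<le> Z xo k + 4 * \<epsilon> * ((t k)\<^sup>2 * (norm (e k))\<^sup>2)" if "k \<ge> K" for k
    proof -
      have "b * (t k)\<^sup>2 * Sinc (g (Suc k) - g k) (y (Suc k) - y k) \<ge> 0"
        unfolding g_def using Sinc_nonneg bpos by (intro mult_nonneg_nonneg) auto
      moreover have "c / 4 * t k * (norm (g k))\<^sup>2 \<ge> 0" using cpos t_gt(3)[of k] by simp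
      ultimately show ?thesis using Z_Suc_le[OF K[OF that] assms] by (simp add: mult.assoc)
    qed
  qed (rule Z_nonneg[OF assms])
  then obtain L where L: "Z xo \<longlonglongrightarrow> L" by (auto simp: convergent_def)
  have "filterlim t at_top sequentially"
    unfolding t using filterlim_tendsto_add_at_top[OF tendsto_const filterlim_real_sequentially, of "3 * s + \<tau>"]
    by (simp add: add_ac)
  then have "(\<lambda>k. w + M0 / t k) \<longlonglongrightarrow> w + 0"
    by (intro tendsto_intros real_tendsto_divide_at_top[OF tendsto_const])
  then have "(\<lambda>k. (Z xo k - A k) / (w + M0 / t k)) \<longlonglongrightarrow> (L - 0) / w"
    using wpos by (intro tendsto_intros L A_tendsto) auto
  moreover have "(Z xo k - A k) / (w + M0 / t k) = (norm (z k - xo))\<^sup>2" for k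
  proof -
    have "w + M0 / t k > 0" using wpos Mpos t_gt(3)[of k] by (simp add: add_pos_pos)
    then show ?thesis by (simp add: Z_def)
  qed
  ultimately have "(\<lambda>k. (norm (z k - xo))\<^sup>2) \<longlonglongrightarrow> L / w" by simp
  from tendsto_real_sqrt[OF this] show ?thesis by (auto simp: convergent_def)
qed

text \<open>Opial's argument: a bounded \<open>z\<close> has a cluster point, continuity of
  \<open>G\<close> makes it a zero, and the convergent distance to this particular zero vanishes
  along a subsequence, hence entirely. The sequences \<open>y\<close> and \<open>x\<close> differ
  from \<open>z\<close> by multiples of \<open>v\<close> with bounded factors, up to an index
  shift.\<close>

lemma iterates_converge:
  assumes "\<exists>p. G p = 0"
  shows "\<exists>p. G p = 0 \<and> x \<longlonglongrightarrow> p \<and> y \<longlonglongrightarrow> p \<and> z \<longlonglongrightarrow> p"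
proof -
  obtain xo where xo: "G xo = 0" using assms by blast
  have v0: "v \<longlonglongrightarrow> 0"
  proof -
    from tendsto_real_sqrt[OF v_facts(2)] have "(\<lambda>k. norm (v k)) \<longlonglongrightarrow> 0" by simp
    then show ?thesis by (rule tendsto_norm_zero_cancel)
  qed
  have g0: "g \<longlonglongrightarrow> 0"
  proof -
    have "(\<lambda>k. (norm (g k))\<^sup>2) \<longlonglongrightarrow> 0"
    proof (rule tendsto_sandwich[OF _ _ tendsto_const g_tendsto])
      have "1 * (norm (g k))\<^sup>2 \<le> (t k - 1)\<^sup>2 * (norm (g k))\<^sup>2" for k
        using t_gt(1)[of k] by (intro mult_right_mono) (auto intro: one_le_power)
      then show "\<forall>\<^sub>F k in sequentially. (norm (g k))\<^sup>2 \<le> (t k - 1)\<^sup>2 * (norm (g k))\<^sup>2" by simp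
    qed auto
    from tendsto_real_sqrt[OF this] have "(\<lambda>k. norm (g k)) \<longlonglongrightarrow> 0" by simp
    then show ?thesis by (rule tendsto_norm_zero_cancel)
  qed
  obtain X where X: "\<And>k. norm (z k - xo) \<le> X"
    using convergent_imp_Bseq[OF dist_convergent[OF xo]] unfolding Bseq_def by auto
  have "bounded (range z)"
    unfolding bounded_iff
  proof (intro exI ballI)
    fix q assume "q \<in> range z"
    then obtain k where "q = z k" by blast
    then show "norm q \<le> X + norm xo"
      using X[of k] norm_triangle_ineq[of "z k - xo" xo] by simp
  qed
  then obtain p r where r: "strict_mono (r :: nat \<Rightarrow> nat)" and zr: "(z \<circ> r) \<longlonglongrightarrow> p"
    using bounded_imp_convergent_subsequence by blast
  have "(\<lambda>k. z (r k) + v (r k)) \<longlonglongrightarrow> p + 0"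
    using zr LIMSEQ_subseq_LIMSEQ[OF v0 r] by (intro tendsto_add) (auto simp: o_def)
  then have yr: "(\<lambda>k. y (r k)) \<longlonglongrightarrow> p" by (simp add: v_def)
  have "isCont G p"
    using cocoercive_continuous[OF betapos coco] by (simp add: continuous_on_eq_continuous_at)
  then have "(\<lambda>k. G (y (r k))) \<longlonglongrightarrow> G p" using yr by (rule isCont_tendsto_compose)
  moreover have "(\<lambda>k. G (y (r k))) \<longlonglongrightarrow> 0"
    using LIMSEQ_subseq_LIMSEQ[OF g0 r] by (simp add: o_def g_def)
  ultimately have Gp: "G p = 0" by (rule LIMSEQ_unique)
  obtain L where L: "(\<lambda>k. norm (z k - p)) \<longlonglongrightarrow> L"
    using dist_convergent[OF Gp] by (auto simp: convergent_def)
  have "(\<lambda>k. norm (z (r k) - p)) \<longlonglongrightarrow> 0"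
    using zr by (intro tendsto_norm_zero LIM_zero) (simp add: o_def)
  moreover have "(\<lambda>k. norm (z (r k) - p)) \<longlonglongrightarrow> L"
    using LIMSEQ_subseq_LIMSEQ[OF L r] by (simp add: o_def)
  ultimately have "L = 0" using LIMSEQ_unique by blast
  then have zp: "z \<longlonglongrightarrow> p" using L by (simp add: tendsto_norm_zero_iff LIM_zero_iff)
  have "(\<lambda>k. z k + v k) \<longlonglongrightarrow> p + 0" by (intro tendsto_add zp v0)
  then have yp: "y \<longlonglongrightarrow> p" by (simp add: v_def)
  have "(\<lambda>k. x (Suc k) - y (Suc k)) \<longlonglongrightarrow> 0"
  proof (rule tendsto_0_le[OF LIMSEQ_Suc[OF v0], of _ s])
    have "norm (x (Suc k) - y (Suc k)) \<le> norm (v (Suc k)) * s" for k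
    proof -
      have "s / (t k - s) \<le> s / 1" using s1 tau1 by (intro divide_left_mono) (auto simp: t)
      then have "s / (t k - s) * norm (v (Suc k)) \<le> s * norm (v (Suc k))"
        by (intro mult_right_mono) auto
      then show ?thesis unfolding x_y using s1 t_gt(2)[of k] by (simp add: mult.commute)
    qed
    then show "\<forall>\<^sub>F k in sequentially. norm (x (Suc k) - y (Suc k)) \<le> norm (v (Suc k)) * s" by simp
  qed
  from tendsto_add[OF this LIMSEQ_Suc[OF yp]] have "(\<lambda>k. x (Suc k)) \<longlonglongrightarrow> p" by simp
  then have "x \<longlonglongrightarrow> p" by (rule LIMSEQ_imp_Suc)
  then show ?thesis using Gp yp zp by blast
qed

end

end

subsection \<open>The stochastic scheme\<close>

text \<open>Both branches of the step size bound imply the same pair \<open>AB\<close>: the formula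
  of the branch gives one inequality, its case condition the other. Then
  \<open>\<theta> \<le> 1\<close> weakens the pair to the two claims.\<close>

lemma eta_bar_bounds:
  assumes \<eta>: "0 < \<eta>" "\<eta> \<le> eta_bar \<Lambda> \<theta> \<tau> \<beta> \<beta>' \<Theta> \<Theta>'"
    and pos: "\<Lambda> > 0" "\<theta> > 0" "\<theta> \<le> 1" "\<tau> \<ge> 1" "0 \<le> \<beta>" "0 \<le> \<beta>'" "0 \<le> \<Theta>" "0 \<le> \<Theta>'"
    and zero: "\<beta>' = 0 \<longrightarrow> \<Theta>' = 0" and ratio: "\<Theta> * \<beta>' \<le> \<Theta>' * \<beta>"
  shows "\<eta> * (1 + \<tau>) + 7 / 3 * \<Lambda> * \<Theta> * \<eta> \<le> \<beta>" "\<Lambda> * (\<Theta>' / \<beta>') * \<eta> \<le> 3 / 7"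
proof -
  define den where "den = 7 * \<Lambda> * \<Theta> + 3 * \<theta> * (1 + \<tau>)"
  have den: "den > 0" unfolding den_def using pos by (intro add_nonneg_pos) auto
  define c where "c = 7 * \<Lambda> * \<Theta>' * \<beta> / den"
  have eb: "eta_bar \<Lambda> \<theta> \<tau> \<beta> \<beta>' \<Theta> \<Theta>' = (if 0 < \<beta>' \<and> \<beta>' \<le> c then 3 * \<theta> * \<beta>' / (7 * \<Lambda> * \<Theta>')
      else if \<beta>' = 0 \<or> (c \<le> \<beta>' \<and> (\<Theta> = 0 \<or> \<beta>' \<le> \<Theta>' / \<Theta> * \<beta>)) then 3 * \<theta> * \<beta> / den else undefined)"
    unfolding eta_bar_def Let_def c_def den_def by simp
  have AB: "\<eta> * den \<le> 3 * \<theta> * \<beta> \<and> 7 * \<Lambda> * \<Theta>' * \<eta> \<le> 3 * \<theta> * \<beta>'"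
  proof (cases "0 < \<beta>' \<and> \<beta>' \<le> c")
    case True
    then have c: "\<beta>' * den \<le> 7 * \<Lambda> * \<Theta>' * \<beta>"
      using den unfolding c_def by (simp add: pos_le_divide_eq)
    have "\<Theta>' \<noteq> 0" using True by (auto simp: c_def)
    then have Tp: "\<Theta>' > 0" using pos by simp
    define l where "l = 7 * \<Lambda> * \<Theta>'"
    have l: "l > 0" using Tp pos by (simp add: l_def)
    have "\<eta> \<le> 3 * \<theta> * \<beta>' / l" using \<eta>(2) True unfolding eb l_def by simp
    then have 1: "\<eta> * l \<le> 3 * \<theta> * \<beta>'" using l by (simp add: pos_le_divide_eq)
    have "l * (\<eta> * den) = (\<eta> * l) * den" by simp
    also have "\<dots> \<le> (3 * \<theta> * \<beta>') * den" using 1 den by (intro mult_right_mono) auto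
    also have "\<dots> = 3 * \<theta> * (\<beta>' * den)" by simp
    also have "\<dots> \<le> 3 * \<theta> * (l * \<beta>)" using c pos by (intro mult_left_mono) (auto simp: l_def)
    also have "\<dots> = l * (3 * \<theta> * \<beta>)" by simp
    finally have "\<eta> * den \<le> 3 * \<theta> * \<beta>" using l by (simp only: mult_le_cancel_left_pos)
    then show ?thesis using 1 by (simp add: l_def mult_ac)
  next
    case False
    have "\<beta>' \<le> \<Theta>' / \<Theta> * \<beta>" if "\<Theta> \<noteq> 0" using ratio that pos by (simp add: field_simps)
    \<comment> \<open>The hypothesis \<open>ratio\<close> rules out the \<open>undefined\<close>
      branch.\<close>
    then have cond: "\<beta>' = 0 \<or> (c \<le> \<beta>' \<and> (\<Theta> = 0 \<or> \<beta>' \<le> \<Theta>' / \<Theta> * \<beta>))"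
      using False pos by force
    then have 1: "\<eta> * den \<le> 3 * \<theta> * \<beta>" using \<eta>(2) False den unfolding eb by (auto simp: field_simps)
    have "7 * \<Lambda> * \<Theta>' * \<eta> \<le> 3 * \<theta> * \<beta>'"
    proof (cases "\<beta>' = 0")
      case False
      then have c: "7 * \<Lambda> * \<Theta>' * \<beta> \<le> \<beta>' * den" using cond den unfolding c_def by (simp add: pos_divide_le_eq)
      have "(7 * \<Lambda> * \<Theta>' * \<eta>) * den = (7 * \<Lambda> * \<Theta>') * (\<eta> * den)" by simp
      also have "\<dots> \<le> (7 * \<Lambda> * \<Theta>') * (3 * \<theta> * \<beta>)" using 1 pos by (intro mult_left_mono) auto
      also have "\<dots> = 3 * \<theta> * (7 * \<Lambda> * \<Theta>' * \<beta>)" by simp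
      also have "\<dots> \<le> 3 * \<theta> * (\<beta>' * den)" using c pos by (intro mult_left_mono) auto
      also have "\<dots> = (3 * \<theta> * \<beta>') * den" by simp
      finally show ?thesis using den by (simp only: mult_le_cancel_right_pos)
    qed (use zero in simp)
    then show ?thesis using 1 by simp
  qed
  have "3 * \<theta> * (\<eta> * (1 + \<tau>) + 7 / 3 * \<Lambda> * \<Theta> * \<eta>) \<le> \<eta> * den"
  proof -
    have "\<theta> * (7 * (\<Lambda> * \<Theta> * \<eta>)) \<le> 1 * (7 * (\<Lambda> * \<Theta> * \<eta>))" using pos \<eta> by (intro mult_right_mono) auto
    then show ?thesis unfolding den_def by (simp add: algebra_simps)
  qed
  also have "\<dots> \<le> 3 * \<theta> * \<beta>" using AB by simp
  finally show "\<eta> * (1 + \<tau>) + 7 / 3 * \<Lambda> * \<Theta> * \<eta> \<le> \<beta>" using pos by simp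
  show "\<Lambda> * (\<Theta>' / \<beta>') * \<eta> \<le> 3 / 7"
  proof (cases "\<beta>' = 0")
    case False
    then have b: "\<beta>' > 0" using pos by simp
    have "7 * \<Lambda> * \<Theta>' * \<eta> \<le> 3 * \<theta> * \<beta>'" using AB by simp
    also have "\<dots> \<le> 3 * \<beta>'" using pos b by simp
    finally show ?thesis using b by (simp add: field_simps)
  qed simp
qed

theorem theorem2:
  fixes M :: "'w measure"
    and F :: "nat \<Rightarrow> 'w measure"
    and G :: "real ^ 'p \<Rightarrow> real ^ 'p"
    and D :: "real ^ 'p \<Rightarrow> real ^ 'p \<Rightarrow> real"
    and x0 y0 :: "real ^ 'p"
    and Gt x y z :: "nat \<Rightarrow> 'w \<Rightarrow> real ^ 'p"
    and \<Delta> :: "int \<Rightarrow> 'w \<Rightarrow> real"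
    and d :: "nat \<Rightarrow> nat"
    and t \<eta>s \<delta> :: "nat \<Rightarrow> real"
    and s \<tau> \<gamma> \<eta> \<beta> \<beta>' \<kappa> \<Theta> \<Theta>' \<alpha> \<Lambda> \<theta> :: real
  assumes "prob_space M"
    and "structural_assumption G \<beta> \<beta>' D"
    and "s > 1"
    and "\<tau> \<ge> 1"
    and "0 < \<gamma>" and "\<gamma> \<le> 1" and "s \<ge> 1 + 3 * \<gamma>"
    and t_def: "\<And>k. t k = real k + 3 * s + \<tau>"
    and eta_def: "\<And>k. \<eta>s k = \<eta> * t k / (2 * (t k - s))"
    and "afp_scheme (space M) s t (\<lambda>k. \<gamma>) \<eta>s x0 y0 Gt x y z"
    and "afp_filtration M F x"
    and "error_condition M F s t \<tau> G \<beta> \<beta>' D y Gt \<Delta> \<kappa> \<Theta> \<Theta>' d \<delta>"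
    and "\<Theta> * \<beta>' \<le> \<Theta>' * \<beta>"
    and "\<alpha> = (2 * s + 1) / (s + 1)\<^sup>2"
    and "\<alpha> < \<kappa>" and "\<kappa> \<le> 1"
    and "\<Lambda> = 1 + s - \<gamma>"
    and "\<theta> = 1 - (1 - \<kappa>) * \<alpha>"
    and "0 < \<eta>" and "\<eta> \<le> eta_bar \<Lambda> \<theta> \<tau> \<beta> \<beta>' \<Theta> \<Theta>'"
    and "summable \<delta>"
  shows "(AE \<omega> in M. summable (\<lambda>k. (real k + \<tau>) * (norm (G (y k \<omega>)))\<^sup>2)) \<and>
    (AE \<omega> in M. summable (\<lambda>k. (real k + \<tau>) * (norm (x (Suc k) \<omega> - x k \<omega>))\<^sup>2)) \<and>
    (AE \<omega> in M. (\<lambda>k. (real k + \<tau>)\<^sup>2 * (norm (G (y k \<omega>)))\<^sup>2) \<longlonglongrightarrow> 0) \<and>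
    (AE \<omega> in M. (\<lambda>k. (real k + \<tau>)\<^sup>2 * (norm (x (Suc k) \<omega> - x k \<omega>))\<^sup>2) \<longlonglongrightarrow> 0) \<and>
    (\<exists>xs \<in> borel_measurable M. (\<forall>\<omega>\<in>space M. xs \<omega> \<in> zer G) \<and>
       (AE \<omega> in M. (\<lambda>k. x k \<omega>) \<longlonglongrightarrow> xs \<omega> \<and> (\<lambda>k. y k \<omega>) \<longlonglongrightarrow> xs \<omega> \<and>
                   (\<lambda>k. z k \<omega>) \<longlonglongrightarrow> xs \<omega>))"
proof -
  note sa = assms(2)[unfolded structural_assumption_def]
  note ec = assms(12)[unfolded error_condition_def Let_def]
  note sch = assms(10)[unfolded afp_scheme_def]
  have fil: "filtration (space M) F" and sub: "\<And>k. subalgebra M (F k)"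
    and xF: "\<And>k. x k \<in> borel_measurable (F k)"
    using assms(11) unfolding afp_filtration_def by auto
  have b0: "0 \<le> \<beta>" "0 \<le> \<beta>'" and D0: "\<And>p q. 0 \<le> D p q"
    and st: "\<And>p q. inner (G p - G q) (p - q) \<ge> \<beta> * (norm (G p - G q))\<^sup>2 + \<beta>' * D p q"
    using sa by auto
  obtain xo where xo: "G xo = 0" using sa by (auto simp: zer_def)
  have eF: "\<And>k. (\<lambda>\<omega>. Gt k \<omega> - G (y k \<omega>)) \<in> borel_measurable (F (Suc k))"
    and Dm: "\<And>j. j \<ge> -1 \<Longrightarrow> \<Delta> j \<in> borel_measurable M"
    and Dn: "\<And>j \<omega>. j \<ge> -1 \<Longrightarrow> \<omega> \<in> space M \<Longrightarrow> 0 \<le> \<Delta> j \<omega>"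
    and kap: "0 < \<kappa>" "\<kappa> \<le> 1" and Th: "0 \<le> \<Theta>" "0 \<le> \<Theta>'"
    and dtau: "\<And>k. real (d k) \<le> \<tau>" and del0: "\<And>k. 0 \<le> \<delta> k"
    and err: "\<And>k. AE \<omega> in M. nn_cond_exp M (F k) (\<lambda>\<omega>. ennreal ((norm (Gt k \<omega> - G (y k \<omega>)))\<^sup>2)) \<omega>
           \<le> nn_cond_exp M (F k) (\<lambda>\<omega>. ennreal (\<Delta> (int k) \<omega>)) \<omega>"
    and rec: "\<And>k. AE \<omega> in M. nn_cond_exp M (F k) (\<lambda>\<omega>. ennreal (\<Delta> (int k) \<omega>)) \<omega>
           \<le> ennreal ((1 - \<kappa>) * \<Delta> (int k - 1) \<omega>
               + (\<Sum>l = k + 1 - d k..k. \<Theta> * (norm (G (y l \<omega>) - G (y (l - 1) \<omega>)))\<^sup>2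
                    + \<Theta>' * D (y l \<omega>) (y (l - 1) \<omega>)) + \<delta> k / (t k * (t k - s)))"
    and z0: "\<beta>' = 0 \<longrightarrow> \<Theta>' = 0"
    using ec by auto
  \<comment> \<open>Through \<open>al2\<close> the assumption \<open>\<alpha> < \<kappa>\<close>
    yields \<open>1 / \<kappa> \<le> 2 s\<close>, the form in which it enters the comparison of
    \<open>b\<close> with the error constant.\<close>
  have al: "0 < \<alpha>" "\<alpha> < 1" and al2: "1 \<le> 2 * s * \<alpha>"
  proof -
    have q: "(s + 1)\<^sup>2 > 0" using assms(3) by simp
    show "0 < \<alpha>" unfolding assms(14) using assms(3) q by simp
    show "\<alpha> < 1" using assms(15,16) by simp
    have "(s + 1)\<^sup>2 \<le> 2 * s * (2 * s + 1)"
    proof -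
      have "s * s \<ge> 1" using mult_mono[of 1 s 1 s] assms(3) by simp
      then show ?thesis by (simp add: power2_eq_square algebra_simps)
    qed
    then show "1 \<le> 2 * s * \<alpha>" unfolding assms(14) using q by (simp add: field_simps)
  qed
  have th: "\<theta> > 0" "\<theta> \<le> 1"
  proof -
    have "(1 - \<kappa>) * \<alpha> \<le> 1 * \<alpha>" using kap al by (intro mult_right_mono) auto
    then show "\<theta> > 0" using al assms(18) by linarith
    show "\<theta> \<le> 1" using kap al unfolding assms(18) by simp
  qed
  \<comment> \<open>For \<open>\<beta>' = 0\<close> the quotient is 0 by the division convention, in
    agreement with \<open>\<Theta>' = 0\<close> in that case.\<close>
  define \<rho> where "\<rho> = \<Theta>' / \<beta>'"
  have Lam: "\<Lambda> > 0" using assms(3,6,17) by simp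
  note eb = eta_bar_bounds[OF assms(19,20) Lam th assms(4) b0 Th z0 assms(13), folded \<rho>_def]
  interpret P: afp_params s \<tau> \<gamma> \<eta> \<beta> \<Theta> \<rho>
    by unfold_locales (use assms eb Th b0 in \<open>auto simp: \<rho>_def\<close>)
  have bD: "\<beta>' * D p q \<le> inner (G p - G q) (p - q) - \<beta> * (norm (G p - G q))\<^sup>2" for p q
    using st[where p = p and q = q] by simp
  have coco: "\<beta> * (norm (G p - G q))\<^sup>2 \<le> inner (G p - G q) (p - q)" for p q
    using bD[of p q] b0(2) D0[of p q] by (meson diff_ge_0_iff_ge mult_nonneg_nonneg order_trans)
  have Sinc_ge: "\<Theta> * (norm (G p - G q))\<^sup>2 + \<Theta>' * D p q \<le> P.Sinc (G p - G q) (p - q)" for p q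
  proof -
    have "\<Theta>' * D p q = \<rho> * (\<beta>' * D p q)" using z0 by (auto simp: \<rho>_def)
    also have "\<dots> \<le> \<rho> * (inner (G p - G q) (p - q) - \<beta> * (norm (G p - G q))\<^sup>2)"
      using bD P.rhonn by (intro mult_left_mono) auto
    finally show ?thesis by (simp add: P.Sinc_def)
  qed
  have path: "afp_path s \<tau> \<gamma> \<eta> \<beta> \<Theta> \<rho> G (\<lambda>k. x k \<omega>) (\<lambda>k. y k \<omega>) (\<lambda>k. z k \<omega>) (\<lambda>k. Gt k \<omega>) t"
    if "\<omega> \<in> space M" for \<omega>
    by unfold_locales (use that sch coco t_def eta_def in \<open>auto\<close>)

  \<comment> \<open>Adaptedness of the iterates\<close>
  have Gm[measurable]: "G \<in> borel_measurable borel"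
    using cocoercive_continuous[OF P.betapos coco] by (rule borel_measurable_continuous_onI)
  have spF: "space (F k) = space M" for k using sub[of k] by (simp add: subalgebra_def)
  have mon: "f \<in> borel_measurable (F i) \<Longrightarrow> i \<le> j \<Longrightarrow> f \<in> borel_measurable (F j)"
    for f :: "'w \<Rightarrow> real ^ 'p" and i j
    using filtration.sets_F_mono[OF fil, of i j] spF
    by (intro measurable_from_subalg[of "F j" "F i"]) (auto simp: subalgebra_def)
  \<comment> \<open>The updates of \<open>z\<close> and \<open>y\<close> can be read as functions of
    \<open>x (Suc k)\<close> and earlier iterates, so adaptedness of \<open>x\<close> passes on to
    them without reference to the estimators. The recursions hold on the sample space only, hence
    the use of \<open>measurable_cong\<close>.\<close>
  have yz: "y k \<in> borel_measurable (F k) \<and> z k \<in> borel_measurable (F k)" for k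
  proof (induction k)
    case 0
    have "y 0 \<in> borel_measurable (F 0) \<longleftrightarrow> (\<lambda>_. y0) \<in> borel_measurable (F 0)"
      "z 0 \<in> borel_measurable (F 0) \<longleftrightarrow> (\<lambda>_. y0) \<in> borel_measurable (F 0)"
      by (rule measurable_cong, use sch spF in simp)+
    then show ?case by simp
  next
    case (Suc k)
    have [measurable]: "y k \<in> borel_measurable (F (Suc k))" "z k \<in> borel_measurable (F (Suc k))"
      "x (Suc k) \<in> borel_measurable (F (Suc k))"
      by - (rule mon[OF conjunct1[OF Suc] le_SucI[OF order_refl]],
          rule mon[OF conjunct2[OF Suc] le_SucI[OF order_refl]], rule xF)
    have "z (Suc k) \<in> borel_measurable (F (Suc k)) \<longleftrightarrow>
        (\<lambda>\<omega>. z k \<omega> + (\<gamma> / s) *\<^sub>R (x (Suc k) \<omega> - y k \<omega>)) \<in> borel_measurable (F (Suc k))"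
      using sch spF by (intro measurable_cong) auto
    then have [measurable]: "z (Suc k) \<in> borel_measurable (F (Suc k))" by simp
    have "y (Suc k) \<in> borel_measurable (F (Suc k)) \<longleftrightarrow>
        (\<lambda>\<omega>. ((t k - s) / t k) *\<^sub>R x (Suc k) \<omega> + (s / t k) *\<^sub>R z (Suc k) \<omega>) \<in> borel_measurable (F (Suc k))"
      using sch spF by (intro measurable_cong) auto
    then show ?case by simp
  qed
  have [measurable]: "y k \<in> borel_measurable (F k)" "z k \<in> borel_measurable (F k)" for k
    using yz by auto
  have yzM[measurable]: "y k \<in> borel_measurable M" "z k \<in> borel_measurable M" for k
    using measurable_from_subalg[OF sub conjunct1[OF yz]] measurable_from_subalg[OF sub conjunct2[OF yz]]
    by blast+

  \<comment> \<open>Summability of the energy and error terms\<close>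
  define N where "N = nat \<lfloor>\<tau>\<rfloor>"
  have N: "real N \<le> \<tau>" unfolding N_def using assms(4) by simp
  have dN: "d k \<le> N" for k using dtau[of k] unfolding N_def by (simp add: le_nat_floor)
  obtain K where K: "K \<ge> 1" "N \<le> K" "\<And>k. k \<ge> K \<Longrightarrow> t k \<ge> P.T"
    "\<And>k. k \<ge> K \<Longrightarrow> (1 - \<kappa>) * (t (Suc k))\<^sup>2 \<le> (1 - \<kappa> / 2) * (t k)\<^sup>2"
    "\<And>k j. k \<ge> K \<Longrightarrow> j < N \<Longrightarrow> (t (Suc k))\<^sup>2 \<le> 2 * (t (k - j))\<^sup>2"
    using P.eventually_weights[OF t_def kap N] by metis

  define Zf where "Zf k \<omega> = s * (t k - 1) * inner (G (y k \<omega>)) (y k \<omega> - z k \<omega>)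
     + \<eta> / 4 * (t k - 1)\<^sup>2 * (norm (G (y k \<omega>)))\<^sup>2 + (P.w + P.M0 / t k) * (norm (z k \<omega> - xo))\<^sup>2" for k \<omega>
  define Sf where "Sf k \<omega> = P.Sinc (G (y k \<omega>) - G (y (k - 1) \<omega>)) (y k \<omega> - y (k - 1) \<omega>)" for k \<omega>
  define Yf where "Yf k \<omega> = P.c / 4 * (t k * (norm (G (y k \<omega>)))\<^sup>2)" for k \<omega>
  define Ef where "Ef k \<omega> = (norm (Gt k \<omega> - G (y k \<omega>)))\<^sup>2" for k \<omega>
  have tpos: "t k > 0" "t k - s > 0" "t k / (t k - s) \<le> 2" for k
    using assms(3,4) by (auto simp: t_def field_simps)
  have energy: "AE \<omega> in M. summable (\<lambda>k. Yf k \<omega>) \<and> summable (\<lambda>k. (t k)\<^sup>2 * Ef k \<omega>)"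
  proof (rule AE_energy_summable[OF assms(1) fil sub, where Z = Zf and S = Sf and \<Delta> = "\<lambda>k. \<Delta> (int k)"
      and b = P.b and ?C0.0 = "4 * P.\<epsilon>" and \<kappa> = \<kappa> and d = d and N = N and K = K and \<delta> = \<delta>
      and dd = "\<lambda>k. \<delta> k / (t k * (t k - s))"])
    fix k
    show "Zf k \<in> borel_measurable (F k)" unfolding Zf_def by measurable
    have [measurable]: "y (k - 1) \<in> borel_measurable (F k)"
      by (rule mon[OF conjunct1[OF yz] diff_le_self])
    show "Sf k \<in> borel_measurable (F k)" unfolding Sf_def P.Sinc_def by measurable
    show "Yf k \<in> borel_measurable M" unfolding Yf_def by measurable
    have [measurable]: "(\<lambda>\<omega>. Gt k \<omega> - G (y k \<omega>)) \<in> borel_measurable M"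
      by (rule measurable_from_subalg[OF sub eF])
    show "Ef k \<in> borel_measurable M" unfolding Ef_def by measurable
    show "\<Delta> (int k) \<in> borel_measurable M" using Dm by simp
    show "AE \<omega> in M. nn_cond_exp M (F k) (\<lambda>\<omega>. ennreal (Ef k \<omega>)) \<omega>
        \<le> nn_cond_exp M (F k) (\<lambda>\<omega>. ennreal (\<Delta> (int k) \<omega>)) \<omega>"
      unfolding Ef_def by (rule err)
    show "AE \<omega> in M. nn_cond_exp M (F (Suc k)) (\<lambda>\<omega>. ennreal (\<Delta> (int (Suc k)) \<omega>)) \<omega>
        \<le> ennreal ((1 - \<kappa>) * \<Delta> (int k) \<omega> + (\<Sum>l = Suc k + 1 - d (Suc k)..Suc k. Sf l \<omega>)
            + \<delta> (Suc k) / (t (Suc k) * (t (Suc k) - s)))"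
      using rec[of "Suc k"]
    proof (rule eventually_mono)
      fix \<omega>
      assume h: "nn_cond_exp M (F (Suc k)) (\<lambda>\<omega>. ennreal (\<Delta> (int (Suc k)) \<omega>)) \<omega>
        \<le> ennreal ((1 - \<kappa>) * \<Delta> (int (Suc k) - 1) \<omega>
               + (\<Sum>l = Suc k + 1 - d (Suc k)..Suc k. \<Theta> * (norm (G (y l \<omega>) - G (y (l - 1) \<omega>)))\<^sup>2
                    + \<Theta>' * D (y l \<omega>) (y (l - 1) \<omega>)) + \<delta> (Suc k) / (t (Suc k) * (t (Suc k) - s)))"
      have i: "int (Suc k) - 1 = int k" by simp
      show "nn_cond_exp M (F (Suc k)) (\<lambda>\<omega>. ennreal (\<Delta> (int (Suc k)) \<omega>)) \<omega>
        \<le> ennreal ((1 - \<kappa>) * \<Delta> (int k) \<omega> + (\<Sum>l = Suc k + 1 - d (Suc k)..Suc k. Sf l \<omega>)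
            + \<delta> (Suc k) / (t (Suc k) * (t (Suc k) - s)))"
        unfolding Sf_def
        by (rule order_trans[OF h[unfolded i]], intro ennreal_leI add_mono sum_mono Sinc_ge order_refl)
    qed
    show "d k \<le> N" by (rule dN)
    show "0 < t k" by (rule tpos)
    show "0 \<le> \<delta> k" by (rule del0)
    show "0 \<le> \<delta> k / (t k * (t k - s))"
      by (intro divide_nonneg_nonneg mult_nonneg_nonneg del0 less_imp_le[OF tpos(1)] less_imp_le[OF tpos(2)])
    \<comment> \<open>The denominator in the error condition matches the weight \<open>t^2\<close>
      up to the factor \<open>t / (t - s)\<close>, which is at most 2.\<close>
    have "(t k)\<^sup>2 * (\<delta> k / (t k * (t k - s))) = t k / (t k - s) * \<delta> k"
      using tpos[of k] by (simp add: power2_eq_square)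
    also have "\<dots> \<le> 2 * \<delta> k" using tpos(3) del0 by (intro mult_right_mono)
    finally show "(t k)\<^sup>2 * (\<delta> k / (t k * (t k - s))) \<le> 2 * \<delta> k" .
    fix \<omega> assume w: "\<omega> \<in> space M"
    interpret Q: afp_path s \<tau> \<gamma> \<eta> \<beta> \<Theta> \<rho> G "\<lambda>k. x k \<omega>" "\<lambda>k. y k \<omega>" "\<lambda>k. z k \<omega>" "\<lambda>k. Gt k \<omega>" t
      by (rule path[OF w])
    have Zeq: "Q.Z xo k = Zf k \<omega>" for k
      unfolding Q.Z_def Q.A_def Q.g_def Q.v_def Zf_def ..
    show "0 \<le> Zf k \<omega>" using Q.Z_nonneg[OF xo, of k] unfolding Zeq .
    show "0 \<le> Yf k \<omega>" unfolding Yf_def using P.cpos tpos(1)[of k] by simp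
    show "0 \<le> Sf k \<omega>" unfolding Sf_def by (rule Q.Sinc_nonneg)
    show "0 \<le> Ef k \<omega>" unfolding Ef_def by simp
    show "0 \<le> \<Delta> (int k) \<omega>" using Dn w by simp
    assume k: "k \<ge> K"
    show "Zf (Suc k) \<omega> + Yf k \<omega> + P.b * (t k)\<^sup>2 * Sf (Suc k) \<omega> \<le> Zf k \<omega> + 4 * P.\<epsilon> * (t k)\<^sup>2 * Ef k \<omega>"
      using Q.Z_Suc_le[OF K(3)[OF k] xo]
      unfolding Zeq Q.g_def Q.e_def by (simp add: Sf_def Yf_def Ef_def mult.assoc)
  next
    show "0 \<le> 4 * P.\<epsilon>" using P.epspos by simp
    \<comment> \<open>The left side equals \<open>(2/3) \<eta> (N / \<tau>) (1 / \<kappa>)\<close>,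
      which is at most \<open>(4/3) s \<eta>\<close>, while \<open>b \<ge> (7/4) s \<eta>\<close>
      because \<open>\<gamma> \<le> 1\<close>.\<close>
    show "4 * real N * (4 * P.\<epsilon>) / \<kappa> < P.b"
    proof -
      have "1 / \<kappa> \<le> 2 * s"
      proof -
        have "1 \<le> 2 * s * \<alpha>" by (rule al2)
        also have "\<dots> \<le> 2 * s * \<kappa>" using assms(3,15) by (intro mult_left_mono) auto
        finally show ?thesis using kap by (simp add: field_simps)
      qed
      moreover have "real N / \<tau> \<le> 1" using N assms(4) by simp
      ultimately have "(real N / \<tau>) * (1 / \<kappa>) \<le> 1 * (2 * s)"
        using kap assms(4) by (intro mult_mono) auto
      then have "2 / 3 * \<eta> * ((real N / \<tau>) * (1 / \<kappa>)) \<le> 2 / 3 * \<eta> * (2 * s)"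
        using assms(19) by (intro mult_left_mono) auto
      moreover have "4 * real N * (4 * P.\<epsilon>) / \<kappa> = 2 / 3 * \<eta> * ((real N / \<tau>) * (1 / \<kappa>))"
        by (simp add: P.\<epsilon>_def)
      moreover have "2 / 3 * \<eta> * (2 * s) < P.b"
      proof -
        have "2 / 3 * (2 * s) < 7 / 4 * (1 + s - \<gamma>)" using assms(3,6) by simp
        then have "\<eta> * (2 / 3 * (2 * s)) < \<eta> * (7 / 4 * (1 + s - \<gamma>))"
          using assms(19) by (rule mult_strict_left_mono)
        then show ?thesis by (simp add: P.b_def mult_ac)
      qed
      ultimately show ?thesis by linarith
    qed
  qed (use K kap assms(21) in auto)

  \<comment> \<open>Almost sure conclusions and the limiting random variable\<close>
  have concl: "AE \<omega> in M. summable (\<lambda>k. (real k + \<tau>) * (norm (G (y k \<omega>)))\<^sup>2) \<and>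
      summable (\<lambda>k. (real k + \<tau>) * (norm (x (Suc k) \<omega> - x k \<omega>))\<^sup>2) \<and>
      (\<lambda>k. (real k + \<tau>)\<^sup>2 * (norm (G (y k \<omega>)))\<^sup>2) \<longlonglongrightarrow> 0 \<and>
      (\<lambda>k. (real k + \<tau>)\<^sup>2 * (norm (x (Suc k) \<omega> - x k \<omega>))\<^sup>2) \<longlonglongrightarrow> 0 \<and>
      (\<exists>p. G p = 0 \<and> (\<lambda>k. x k \<omega>) \<longlonglongrightarrow> p \<and> (\<lambda>k. y k \<omega>) \<longlonglongrightarrow> p \<and> (\<lambda>k. z k \<omega>) \<longlonglongrightarrow> p)"
    using energy
  proof (rule AE_mp, intro AE_I2 impI)
    fix \<omega> assume w: "\<omega> \<in> space M" and h: "summable (\<lambda>k. Yf k \<omega>) \<and> summable (\<lambda>k. (t k)\<^sup>2 * Ef k \<omega>)"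
    interpret Q: afp_path s \<tau> \<gamma> \<eta> \<beta> \<Theta> \<rho> G "\<lambda>k. x k \<omega>" "\<lambda>k. y k \<omega>" "\<lambda>k. z k \<omega>" "\<lambda>k. Gt k \<omega>" t
      by (rule path[OF w])
    have "summable (\<lambda>k. P.c / 4 * (t k * (norm (Q.g k))\<^sup>2))" using h by (simp only: Yf_def Q.g_def)
    then have g: "summable (\<lambda>k. t k * (norm (Q.g k))\<^sup>2)"
      by (rule summable_mult_D) (use P.cpos in simp)
    have e: "summable (\<lambda>k. (t k)\<^sup>2 * (norm (Q.e k))\<^sup>2)" using h by (simp only: Ef_def Q.e_def Q.g_def)
    show "summable (\<lambda>k. (real k + \<tau>) * (norm (G (y k \<omega>)))\<^sup>2) \<and>
      summable (\<lambda>k. (real k + \<tau>) * (norm (x (Suc k) \<omega> - x k \<omega>))\<^sup>2) \<and>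
      (\<lambda>k. (real k + \<tau>)\<^sup>2 * (norm (G (y k \<omega>)))\<^sup>2) \<longlonglongrightarrow> 0 \<and>
      (\<lambda>k. (real k + \<tau>)\<^sup>2 * (norm (x (Suc k) \<omega> - x k \<omega>))\<^sup>2) \<longlonglongrightarrow> 0 \<and>
      (\<exists>p. G p = 0 \<and> (\<lambda>k. x k \<omega>) \<longlonglongrightarrow> p \<and> (\<lambda>k. y k \<omega>) \<longlonglongrightarrow> p \<and> (\<lambda>k. z k \<omega>) \<longlonglongrightarrow> p)"
      by (intro conjI Q.sum_G[OF g e] Q.sum_x[OF g e] Q.lim_G[OF g e] Q.lim_x[OF g e]
          Q.iterates_converge[OF g e] exI[of _ xo] xo)
  qed
  \<comment> \<open>\<open>lim\<close> is meaningful only off the null set \<open>U\<close>; on \<open>U\<close> the limit is set to the zero \<open>xo\<close>.\<close>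
  define conv where "conv \<omega> \<longleftrightarrow> (\<exists>p. G p = 0 \<and> (\<lambda>k. x k \<omega>) \<longlonglongrightarrow> p \<and> (\<lambda>k. y k \<omega>) \<longlonglongrightarrow> p \<and> (\<lambda>k. z k \<omega>) \<longlonglongrightarrow> p)" for \<omega>
  have "AE \<omega> in M. conv \<omega>" using concl by (rule eventually_mono) (simp add: conv_def)
  then obtain U where U: "U \<in> null_sets M" "{\<omega> \<in> space M. \<not> conv \<omega>} \<subseteq> U"
    unfolding eventually_ae_filter by blast
  define xs where "xs \<omega> = (if \<omega> \<in> U then xo else lim (\<lambda>k. z k \<omega>))" for \<omega>
  have good: "G (xs \<omega>) = 0 \<and> (\<lambda>k. x k \<omega>) \<longlonglongrightarrow> xs \<omega> \<and> (\<lambda>k. y k \<omega>) \<longlonglongrightarrow> xs \<omega> \<and> (\<lambda>k. z k \<omega>) \<longlonglongrightarrow> xs \<omega>"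
    if w: "\<omega> \<in> space M" "\<omega> \<notin> U" for \<omega>
  proof -
    obtain p where p: "G p = 0" "(\<lambda>k. x k \<omega>) \<longlonglongrightarrow> p" "(\<lambda>k. y k \<omega>) \<longlonglongrightarrow> p" "(\<lambda>k. z k \<omega>) \<longlonglongrightarrow> p"
      using w U(2) unfolding conv_def by blast
    have "xs \<omega> = p" using w(2) limI[OF p(4)] by (simp add: xs_def)
    then show ?thesis using p by simp
  qed
  have Us[measurable]: "U \<in> sets M" using U(1) by auto
  \<comment> \<open>Altering \<open>z\<close> on the measurable null set \<open>U\<close> makes it
    converge at every point, so its limit is measurable without completeness of
    \<open>M\<close>.\<close>
  have xsm: "xs \<in> borel_measurable M"
  proof (rule borel_measurable_LIMSEQ_metric[where f = "\<lambda>k \<omega>. if \<omega> \<in> U then xo else z k \<omega>"])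
    show "(\<lambda>\<omega>. if \<omega> \<in> U then xo else z k \<omega>) \<in> borel_measurable M" for k by measurable
    show "(\<lambda>k. if \<omega> \<in> U then xo else z k \<omega>) \<longlonglongrightarrow> xs \<omega>" if "\<omega> \<in> space M" for \<omega>
      using good[OF that] by (cases "\<omega> \<in> U") (auto simp: xs_def)
  qed
  have xsz: "xs \<omega> \<in> zer G" if "\<omega> \<in> space M" for \<omega>
    using good[OF that] xo by (cases "\<omega> \<in> U") (auto simp: xs_def zer_def)
  have "AE \<omega> in M. \<omega> \<notin> U" using U(1) by (rule AE_not_in)
  then have lims: "AE \<omega> in M. (\<lambda>k. x k \<omega>) \<longlonglongrightarrow> xs \<omega> \<and> (\<lambda>k. y k \<omega>) \<longlonglongrightarrow> xs \<omega> \<and> (\<lambda>k. z k \<omega>) \<longlonglongrightarrow> xs \<omega>"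
    by (rule AE_mp) (use good in \<open>auto intro!: AE_I2\<close>)
  have "AE \<omega> in M. summable (\<lambda>k. (real k + \<tau>) * (norm (G (y k \<omega>)))\<^sup>2)"
    "AE \<omega> in M. summable (\<lambda>k. (real k + \<tau>) * (norm (x (Suc k) \<omega> - x k \<omega>))\<^sup>2)"
    "AE \<omega> in M. (\<lambda>k. (real k + \<tau>)\<^sup>2 * (norm (G (y k \<omega>)))\<^sup>2) \<longlonglongrightarrow> 0"
    "AE \<omega> in M. (\<lambda>k. (real k + \<tau>)\<^sup>2 * (norm (x (Suc k) \<omega> - x k \<omega>))\<^sup>2) \<longlonglongrightarrow> 0"
    by (rule eventually_mono[OF concl], blast)+
  then show ?thesis using xsm xsz lims by blast
qed

end
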